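(* Fix $\gamma\ge0$. There exist positive constants $c_{\mathcal A},c_{\mathcal B},c_{\mathcal C}$ (independent of $N,p,q$) such that for every real $N\ge0$ and all $p,q\in[1,\infty]$ (with $1/\infty=0$): (i) if $\frac12\le\frac1p\le 1$ and $1-\frac1p\le\frac1q\le 1$, then $c_{\mathcal A}^{-1}(1+N)^{-1+1/p}\le C_N(p\to q)\le c_{\mathcal A}(1+N)^{-1+1/p}$; (ii) if $0\le\frac1q\le\frac12$ and $0\le\frac1p\le1-\frac1q$, then $c_{\mathcal B}^{-1}(1+N)^{-1/q}\le C_N(p\to q)\le c_{\mathcal B}(1+N)^{-1/q}$; (iii) if $0\le\frac1p\le\frac12$ and $\frac12\le\frac1q\le1$, then $c_{\mathcal C}^{-1}(1+N)^{-1/2}\le C_N(p\to q)\le c_{\mathcal C}(1+N)^{-1/2}$.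
   Context: For fixed $\gamma\ge0$ and $N\ge0$, $T_N$ is the linear integral operator $$T_Nf(t)=\int_0^1 e^{\mathrm i N/(1+t+s)}\,\frac{f(s)}{(1+t+s)^{\gamma}}\,ds,\qquad t\in[0,1],$$ acting on complex-valued functions $f\in L^p([0,1])$. The $L^p$ norms on $[0,1]$ are the usual ones with respect to Lebesgue measure (essential supremum for $p=\infty$). The constant $C_N(p\to q)$ is the operator norm $$C_N(p\to q)=\sup_{f\in L^p([0,1])\setminus\{0\}}\frac{\|T_Nf\|_{L^q([0,1])}}{\|f\|_{L^p([0,1])}}.$$ *)

theory Defs
  imports "HOL-Analysis.Analysis" "HOL-Probability.Essential_Supremum"
begin

abbreviation unit_lebesgue :: "real measure" where
  "unit_lebesgue \<equiv> lebesgue_on {0..1}"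

text \<open>Exponents \<open>p \<in> [1,\<infinity>]\<close> are extended nonnegative reals; \<open>1/p\<close> is read as a real number,
  with \<open>1/\<infinity> = 0\<close>.\<close>

definition recip :: "ennreal \<Rightarrow> real" where
  "recip p = enn2real (1 / p)"

lemma recip_infinity [simp]: "recip \<infinity> = 0"
  by (simp add: recip_def)

lemma recip_ennreal: "r > 0 \<Longrightarrow> recip (ennreal r) = 1 / r"
  by (simp add: recip_def divide_ennreal flip: ennreal_1)

text \<open>The norm takes the value \<open>\<infinity>\<close> when the integral diverges. The case distinction on the
  integral is needed because \<open>enn2real \<infinity> = 0\<close>.\<close>

definition Lp_norm :: "'a measure \<Rightarrow> ennreal \<Rightarrow> ('a \<Rightarrow> complex) \<Rightarrow> ennreal" where
  "Lp_norm M p f =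
     (if p = \<infinity> then esssup M (\<lambda>x. ennreal (norm (f x)))
      else let I = (\<integral>\<^sup>+ x. ennreal (norm (f x) powr enn2real p) \<partial>M)
           in if I = \<infinity> then \<infinity> else ennreal (enn2real I powr recip p))"

definition Lp_funs :: "'a measure \<Rightarrow> ennreal \<Rightarrow> ('a \<Rightarrow> complex) set" where
  "Lp_funs M p = {f \<in> borel_measurable M. Lp_norm M p f < \<infinity>}"

definition T_op :: "real \<Rightarrow> real \<Rightarrow> (real \<Rightarrow> complex) \<Rightarrow> real \<Rightarrow> complex" where
  "T_op \<gamma> N f t =
     (LINT s|unit_lebesgue.
        exp (\<i> * of_real (N / (1 + t + s))) * (f s / of_real ((1 + t + s) powr \<gamma>)))"

text \<open>Elements of \<open>Lp_funs\<close> are functions rather than equivalence classes, so the nonzero ones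
  are those that do not vanish almost everywhere. The supremum is \<open>\<infinity>\<close> if the operator is
  unbounded.\<close>

definition C_const :: "real \<Rightarrow> real \<Rightarrow> ennreal \<Rightarrow> ennreal \<Rightarrow> ennreal" where
  "C_const \<gamma> N p q =
     (SUP f \<in> {f \<in> Lp_funs unit_lebesgue p. \<not> (AE x in unit_lebesgue. f x = 0)}.
        Lp_norm unit_lebesgue q (T_op \<gamma> N f) / Lp_norm unit_lebesgue p f)"

end

theory Submission
  imports Defs "HOL-Probability.Probability_Measure" "HOL-Complex_Analysis.Conformal_Mappings"
begin

text \<open>
  Upper bounds: \<open>T\<^sub>N\<close> has norm at most \<open>1\<close> from \<open>L\<^sup>1\<close> to \<open>L\<^sup>\<infinity>\<close>, and norm \<open>O((1 + N) powr (-1/2))\<close>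
  on \<open>L\<^sup>2\<close>. For the latter, insert a smooth cutoff in \<open>t\<close> that vanishes to second order at the
  ends of an interval containing \<open>[0,1]\<close> in its interior (a sharp cutoff would lose a logarithm);
  two integrations by parts bound the kernel of \<open>T\<^sub>N\<^sup>* T\<^sub>N\<close> by a multiple of
  \<open>1 / (1 + N\<^sup>2 (s - s')\<^sup>2)\<close>, and Schur's test applies. Riesz--Thorin gives the line
  \<open>1/p + 1/q = 1\<close>, \<open>p \<le> 2\<close>, with a constant independent of \<open>p\<close>, and the monotonicity of the
  norms on a probability space gives all other exponents.

  Lower bounds: (i) the indicator of \<open>[0, 1/(1 + N)]\<close>, on which the kernel hardly oscillates;
  (ii) \<open>f s = exp (- i N / (1 + s))\<close>, which removes the oscillation for \<open>t \<le> 1/(1 + N)\<close>;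
  (iii) a combination of the indicators of about \<open>N\<close> intervals of length about \<open>1/N\<close> with
  random signs, for which Khintchine's inequality shows that \<open>\<bar>T\<^sub>N f\<bar>\<close> is on average at least a
  multiple of \<open>N powr (-1/2)\<close>.
\<close>

section \<open>Three lines theorem\<close>

text \<open>In all three cases the exponent is x - 1 with x = max (1/p, 1 - 1/q, 1/2): the pair with
  reciprocals (x, 1 - x) is the best point of the conjugate line from which embeddings on [0,1]
  reach (p, q), and the regions record which term is the maximum. One family of estimates along that
  line therefore yields every upper bound, provided that its constant is uniform. The delicate end
  is L^2. A boundary term in t would be of size 1/(N |s - s'|), and min (1, 1/(N |s - s'|)) has row
  integrals of order log N / N instead of 1/N. There is room for a cutoff outside [0,1] because 1 +
  t + s \<ge> 1/2 for t \<ge> -1/2. A polynomial cutoff keeps the twice differentiated weight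
  explicit. At both ends, L^1 to L^\<infinity> and L^2 to L^2, the source exponent is the dual of
  the target exponent, so a single analytic family serves the input and the dual test function
  alike.\<close>

lemma three_lines_unit:
  fixes F :: "complex \<Rightarrow> complex"
  assumes hol: "F holomorphic_on UNIV"
    and bdd: "\<And>z. 0 \<le> Re z \<Longrightarrow> Re z \<le> 1 \<Longrightarrow> cmod (F z) \<le> L"
    and left: "\<And>z. Re z = 0 \<Longrightarrow> cmod (F z) \<le> 1"
    and right: "\<And>z. Re z = 1 \<Longrightarrow> cmod (F z) \<le> 1"
    and z: "0 \<le> Re z" "Re z \<le> 1"
  shows "cmod (F z) \<le> 1"
proof -
  \<comment> \<open>On the strip the factor \<open>exp (\<epsilon> * (w^2 - 1))\<close> has modulus
    at most 1 and decays like a Gaussian in \<open>Im w\<close>. It turns mere boundedness of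
    \<open>F\<close> into smallness on the horizontal sides of a tall rectangle, where the maximum
    principle applies; then \<epsilon> tends to 0.\<close>
  have damped: "cmod (F z) * exp (\<epsilon> * ((Re z)\<^sup>2 - (Im z)\<^sup>2 - 1)) \<le> 1" if \<epsilon>: "\<epsilon> > 0" for \<epsilon> :: real
  proof -
    define G where "G = (\<lambda>w. F w * exp (of_real \<epsilon> * (w\<^sup>2 - 1)))"
    have normG: "cmod (G w) = cmod (F w) * exp (\<epsilon> * ((Re w)\<^sup>2 - (Im w)\<^sup>2 - 1))" for w
      by (simp add: G_def norm_mult Re_power2)
    define L' where "L' = max L 1"
    \<comment> \<open>This height makes \<open>L' * exp (- \<epsilon> * R^2)\<close> at most 1 and
      keeps \<open>z\<close> inside the rectangle.\<close>
    define R where "R = max (sqrt (ln L' / \<epsilon>)) \<bar>Im z\<bar>"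
    have L': "L' \<ge> 1" "L \<le> L'" by (auto simp: L'_def)
    have R: "R \<ge> 0" "\<bar>Im z\<bar> \<le> R" by (auto simp: R_def)
    have "sqrt (ln L' / \<epsilon>) \<le> R" by (auto simp: R_def)
    hence "(sqrt (ln L' / \<epsilon>))\<^sup>2 \<le> R\<^sup>2"
      by (rule power_mono) (use L' \<epsilon> in auto)
    hence R2: "ln L' \<le> \<epsilon> * R\<^sup>2"
      using L' \<epsilon> by (simp add: field_simps)
    have decay: "L' * exp (\<epsilon> * (x\<^sup>2 - R\<^sup>2 - 1)) \<le> 1" if "0 \<le> x" "x \<le> 1" for x :: real
    proof -
      have "x\<^sup>2 \<le> 1" using that by (simp add: power_le_one)
      hence "\<epsilon> * (x\<^sup>2 - 1) \<le> 0" using \<epsilon> by (simp add: mult_le_0_iff)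
      hence "ln L' + \<epsilon> * (x\<^sup>2 - R\<^sup>2 - 1) \<le> 0"
        using R2 by (simp add: algebra_simps)
      hence "exp (ln L' + \<epsilon> * (x\<^sup>2 - R\<^sup>2 - 1)) \<le> 1" by simp
      thus ?thesis using L' by (simp add: exp_add)
    qed
    define S where "S = cbox (Complex 0 (-R)) (Complex 1 R)"
    have S: "w \<in> S \<longleftrightarrow> 0 \<le> Re w \<and> Re w \<le> 1 \<and> -R \<le> Im w \<and> Im w \<le> R" for w
      by (simp add: S_def in_cbox_complex_iff)
    have holG: "G holomorphic_on UNIV" unfolding G_def
      by (intro holomorphic_intros hol)
    have "cmod (G z) \<le> 1"
    proof (rule maximum_modulus_frontier[of G S])
      show "G holomorphic_on interior S" using holG holomorphic_on_subset by blast
      show "continuous_on (closure S) G"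
        using holG holomorphic_on_imp_continuous_on continuous_on_subset by blast
      show "bounded S" by (simp add: S_def)
      show "z \<in> S" using z R by (auto simp: S)
      fix w assume "w \<in> frontier S"
      hence "w \<in> cbox (Complex 0 (-R)) (Complex 1 R) - box (Complex 0 (-R)) (Complex 1 R)"
        by (simp add: S_def frontier_cbox)
      hence w: "0 \<le> Re w" "Re w \<le> 1" and
        edge: "Re w = 0 \<or> Re w = 1 \<or> Im w = R \<or> Im w = -R"
        by (auto simp: in_cbox_complex_iff in_box_complex_iff)
      show "cmod (G w) \<le> 1"
      proof (cases "Re w = 0 \<or> Re w = 1")
        case True
        have "(Re w)\<^sup>2 - 1 \<le> 0" using True by auto
        hence "(Re w)\<^sup>2 - (Im w)\<^sup>2 - 1 \<le> 0" using zero_le_power2[of "Im w"] by linarith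
        hence "exp (\<epsilon> * ((Re w)\<^sup>2 - (Im w)\<^sup>2 - 1)) \<le> 1"
          using \<epsilon> by (simp add: mult_le_0_iff)
        moreover have "cmod (F w) \<le> 1" using True left right by auto
        ultimately show ?thesis unfolding normG by (intro mult_le_one) auto
      next
        case False
        hence "(Im w)\<^sup>2 = R\<^sup>2" using edge by auto
        have "cmod (F w) \<le> L'" using bdd[OF w] L' by linarith
        hence "cmod (G w) \<le> L' * exp (\<epsilon> * ((Re w)\<^sup>2 - R\<^sup>2 - 1))"
          unfolding normG \<open>(Im w)\<^sup>2 = R\<^sup>2\<close> by (intro mult_right_mono) auto
        also have "\<dots> \<le> 1" by (rule decay[OF w])
        finally show ?thesis .
      qed
    qed
    thus ?thesis by (simp add: normG)
  qed
  have "((\<lambda>\<epsilon>. cmod (F z) * exp (\<epsilon> * ((Re z)\<^sup>2 - (Im z)\<^sup>2 - 1))) \<longlongrightarrow> cmod (F z) * exp (0 * ((Re z)\<^sup>2 - (Im z)\<^sup>2 - 1))) (at_right 0)"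
    by (intro tendsto_intros)
  hence "((\<lambda>\<epsilon>. cmod (F z) * exp (\<epsilon> * ((Re z)\<^sup>2 - (Im z)\<^sup>2 - 1))) \<longlongrightarrow> cmod (F z)) (at_right 0)"
    by simp
  thus ?thesis
    by (rule tendsto_upperbound) (auto simp: eventually_at_right_less intro!: eventually_mono[OF eventually_at_right_less[of 0]] damped)
qed

lemma three_lines:
  fixes F :: "complex \<Rightarrow> complex" and a b L :: real
  assumes hol: "F holomorphic_on UNIV"
    and bdd: "\<And>z. 0 \<le> Re z \<Longrightarrow> Re z \<le> 1 \<Longrightarrow> cmod (F z) \<le> L"
    and left: "\<And>z. Re z = 0 \<Longrightarrow> cmod (F z) \<le> a"
    and right: "\<And>z. Re z = 1 \<Longrightarrow> cmod (F z) \<le> b"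
    and pos: "a > 0" "b > 0"
    and z: "0 \<le> Re z" "Re z \<le> 1"
  shows "cmod (F z) \<le> a powr (1 - Re z) * b powr Re z"
proof -
  \<comment> \<open>Division by the zero-free entire function a^(1 - w) b^w reduces to boundary
    values at most 1. The modulus of the divisor depends only on \<open>Re w\<close>, so compactness
    of [0,1] keeps the quotient bounded on the strip.\<close>
  define G where "G = (\<lambda>w. F w * exp ((w - 1) * of_real (ln a) - w * of_real (ln b)))"
  have normG: "cmod (G w) = cmod (F w) / (a powr (1 - Re w) * b powr Re w)" for w
  proof -
    have "Re ((w - 1) * of_real (ln a) - w * of_real (ln b)) = - ((1 - Re w) * ln a + Re w * ln b)"
      by (simp add: algebra_simps)
    thus ?thesis
      using pos unfolding G_def norm_mult norm_exp_eq_Re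
      by (simp add: powr_def exp_diff exp_minus divide_inverse)
  qed
  have cont: "continuous_on {0..1} (\<lambda>x::real. \<bar>L\<bar> / (a powr (1 - x) * b powr x))"
    using pos by (intro continuous_intros) auto
  have "compact ((\<lambda>x::real. \<bar>L\<bar> / (a powr (1 - x) * b powr x)) ` {0..1})"
    by (rule compact_continuous_image[OF cont]) simp
  then obtain K where K: "\<And>x. x \<in> {0..1} \<Longrightarrow> \<bar>\<bar>L\<bar> / (a powr (1 - x) * b powr x)\<bar> \<le> K"
    using bounded_real compact_imp_bounded
    by (metis (no_types, lifting) imageI)
  have "cmod (G z) \<le> 1"
  proof (rule three_lines_unit[where F = G])
    show "G holomorphic_on UNIV" unfolding G_def by (intro holomorphic_intros hol)
    show "cmod (G w) \<le> 1" if "Re w = 0" for w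
      using left[OF that] pos that by (simp add: normG)
    show "cmod (G w) \<le> 1" if "Re w = 1" for w
      using right[OF that] pos that by (simp add: normG)
    show "0 \<le> Re z" "Re z \<le> 1" by fact+
    show "cmod (G w) \<le> K" if w: "0 \<le> Re w" "Re w \<le> 1" for w
    proof -
      have "cmod (G w) \<le> \<bar>L\<bar> / (a powr (1 - Re w) * b powr Re w)"
        unfolding normG using bdd[OF w] pos by (intro divide_right_mono) auto
      thus ?thesis using K[of "Re w"] w by auto
    qed
  qed
  thus ?thesis using pos by (simp add: normG divide_le_eq)
qed

section \<open>Norms on a probability space\<close>

lemma recip_top [simp]: "recip top = 0"
  using recip_infinity by (simp only: infinity_ennreal_def)

lemma exponent_cases:
  assumes "1 \<le> p"
  obtains "p = \<infinity>" "recip p = 0" | r where "p = ennreal r" "r \<ge> 1" "recip p = 1 / r"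
proof (cases p)
  case (real r)
  with assms have "r \<ge> 1" by (metis ennreal_1 ennreal_le_iff2 not_one_le_zero)
  thus ?thesis using that(2)[of r] real by (simp add: recip_ennreal)
next
  case top
  thus ?thesis using that(1) by simp
qed

lemma exponent_le_iff_recip:
  assumes "1 \<le> p" "1 \<le> q"
  shows "p \<le> q \<longleftrightarrow> recip q \<le> recip p"
  using assms(1)
proof (cases rule: exponent_cases)
  case 1
  show ?thesis using assms(2) by (cases rule: exponent_cases) (use 1 in \<open>auto simp: top_unique\<close>)
next
  case (2 r)
  show ?thesis using assms(2)
    by (cases rule: exponent_cases) (use 2 in \<open>auto simp: divide_le_cancel frac_le divide_le_eq le_divide_eq\<close>)
qed

lemma exponent_with_recip:
  assumes "0 \<le> x" "x \<le> 1"
  obtains p where "1 \<le> p" "recip p = x"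
proof (cases "x = 0")
  case True
  thus ?thesis using that[of top] by simp
next
  case False
  hence "ennreal 1 \<le> ennreal (1 / x)" using assms by (intro ennreal_leI) simp
  thus ?thesis using that[of "ennreal (1 / x)"] assms False by (simp add: recip_ennreal)
qed

lemma Lp_norm_ennreal:
  assumes "r > 0"
  shows "Lp_norm M (ennreal r) f =
    (let I = \<integral>\<^sup>+ x. ennreal (norm (f x) powr r) \<partial>M
     in if I = \<infinity> then \<infinity> else ennreal (enn2real I powr (1 / r)))"
  using assms by (simp add: Lp_norm_def recip_ennreal Let_def)

lemma Lp_norm_leI:
  assumes "r > 0" "c \<ge> 0" "(\<integral>\<^sup>+ x. ennreal (norm (f x) powr r) \<partial>M) \<le> ennreal (c powr r)"
  shows "Lp_norm M (ennreal r) f \<le> ennreal c"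
proof -
  define I where "I = (\<integral>\<^sup>+ x. ennreal (norm (f x) powr r) \<partial>M)"
  have "I < \<infinity>" using assms(3) by (simp add: I_def le_less_trans)
  moreover have "enn2real I \<le> c powr r"
    using assms(3) by (simp add: I_def enn2real_leI)
  hence "enn2real I powr (1 / r) \<le> (c powr r) powr (1 / r)"
    using assms by (intro powr_mono2) auto
  ultimately show ?thesis
    using assms by (auto simp: Lp_norm_ennreal Let_def powr_powr intro!: ennreal_leI simp flip: I_def)
qed

lemma Lp_norm_geI:
  assumes "r > 0" "c \<ge> 0" "ennreal (c powr r) \<le> (\<integral>\<^sup>+ x. ennreal (norm (f x) powr r) \<partial>M)"
  shows "ennreal c \<le> Lp_norm M (ennreal r) f"
proof (cases "(\<integral>\<^sup>+ x. ennreal (norm (f x) powr r) \<partial>M) = \<infinity>")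
  case True
  thus ?thesis using assms by (simp add: Lp_norm_ennreal)
next
  case False
  define I where "I = (\<integral>\<^sup>+ x. ennreal (norm (f x) powr r) \<partial>M)"
  have "I < \<infinity>" using False by (simp add: I_def less_top)
  hence "c powr r \<le> enn2real I"
    using assms(3) enn2real_mono[of "ennreal (c powr r)" I] by (simp add: I_def)
  hence "(c powr r) powr (1 / r) \<le> enn2real I powr (1 / r)"
    using assms by (intro powr_mono2) auto
  thus ?thesis
    using assms False by (auto simp: Lp_norm_ennreal Let_def powr_powr I_def intro!: ennreal_leI)
qed

lemma Lp_norm_finite_integral:
  assumes "r > 0" "f \<in> Lp_funs M (ennreal r)"
  obtains I where "I \<ge> 0" "(\<integral>\<^sup>+ x. ennreal (norm (f x) powr r) \<partial>M) = ennreal I"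
    "Lp_norm M (ennreal r) f = ennreal (I powr (1 / r))"
proof -
  have "(\<integral>\<^sup>+ x. ennreal (norm (f x) powr r) \<partial>M) \<noteq> \<infinity>"
    using assms by (auto simp: Lp_funs_def Lp_norm_ennreal)
  then obtain I where "I \<ge> 0" "(\<integral>\<^sup>+ x. ennreal (norm (f x) powr r) \<partial>M) = ennreal I"
    by (metis ennreal_cases infinity_ennreal_def)
  thus ?thesis using that assms by (simp add: Lp_norm_ennreal)
qed

lemma Lp_norm_infinity_leI:
  assumes "f \<in> borel_measurable M" "AE x in M. norm (f x) \<le> c"
  shows "Lp_norm M \<infinity> f \<le> ennreal c"
  unfolding Lp_norm_def using assms
  by (auto intro!: esssup_I elim!: eventually_mono ennreal_leI)

lemma Lp_norm_pos:
  assumes "f \<in> borel_measurable M" "\<not> (AE x in M. f x = 0)" "1 \<le> p"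
  shows "0 < Lp_norm M p f"
proof (rule ccontr)
  assume "\<not> 0 < Lp_norm M p f"
  hence 0: "Lp_norm M p f = 0" by simp
  from \<open>1 \<le> p\<close> have "AE x in M. f x = 0"
  proof (cases rule: exponent_cases)
    case 1
    have "AE x in M. ennreal (norm (f x)) \<le> esssup M (\<lambda>x. ennreal (norm (f x)))"
      by (rule esssup_AE)
    thus ?thesis using 0 1 by (simp add: Lp_norm_def)
  next
    case (2 r)
    define I where "I = (\<integral>\<^sup>+ x. ennreal (norm (f x) powr r) \<partial>M)"
    have "I \<noteq> \<infinity>" "enn2real I = 0"
      using 0 2 by (auto simp: Lp_norm_ennreal Let_def I_def split: if_splits)
    hence "I = 0" by (simp add: enn2real_eq_0_iff)
    thus ?thesis using assms(1) unfolding I_def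
      by (subst (asm) nn_integral_0_iff_AE) auto
  qed
  thus False using assms by simp
qed

text \<open>For finite exponents this is Jensen's inequality, obtained by integrating a pointwise
  Young inequality. The integral \<open>J\<close> of the s-th power is used as normalisation, hence
  the separate treatment of J = 0.\<close>

lemma (in prob_space) Lp_norm_mono:
  assumes [measurable]: "f \<in> borel_measurable M" and "1 \<le> p" "p \<le> q"
  shows "Lp_norm M p f \<le> Lp_norm M q f"
proof -
  have "1 \<le> q" using assms by simp
  from \<open>1 \<le> p\<close> show ?thesis
  proof (cases rule: exponent_cases)
    case 1
    thus ?thesis using assms by (simp add: top_unique)
  next
    case (2 r)
    note p = 2
    from \<open>1 \<le> q\<close> show ?thesis
    proof (cases rule: exponent_cases)
      case 1
      define E where "E = esssup M (\<lambda>x. ennreal (norm (f x)))"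
      have AE: "AE x in M. ennreal (norm (f x)) \<le> E" unfolding E_def by (rule esssup_AE)
      show ?thesis
      proof (cases E)
        case (real c)
        have "AE x in M. ennreal (norm (f x) powr r) \<le> ennreal (c powr r)"
          using AE p real by (auto elim!: eventually_mono intro!: ennreal_leI powr_mono2)
        hence "(\<integral>\<^sup>+ x. ennreal (norm (f x) powr r) \<partial>M) \<le> (\<integral>\<^sup>+ x. ennreal (c powr r) \<partial>M)"
          by (rule nn_integral_mono_AE)
        hence "(\<integral>\<^sup>+ x. ennreal (norm (f x) powr r) \<partial>M) \<le> ennreal (c powr r)"
          by (simp add: emeasure_space_1)
        hence "Lp_norm M (ennreal r) f \<le> ennreal c" using p real by (intro Lp_norm_leI) auto
        thus ?thesis using p 1 real by (simp add: Lp_norm_def E_def)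
      next
        case top
        thus ?thesis using 1 by (simp add: Lp_norm_def E_def)
      qed
    next
      case (2 s)
      note q = 2
      have rs: "r \<le> s" "r > 0" "s > 0" using assms p q by auto
      show ?thesis
      proof (cases "Lp_norm M q f = \<infinity>")
        case False
        hence "f \<in> Lp_funs M (ennreal s)" using q by (simp add: Lp_funs_def less_top)
        then obtain J where J: "J \<ge> 0" "(\<integral>\<^sup>+ x. ennreal (norm (f x) powr s) \<partial>M) = ennreal J"
          "Lp_norm M (ennreal s) f = ennreal (J powr (1 / s))"
          using Lp_norm_finite_integral rs by metis
        show ?thesis
        proof (cases "J = 0")
          case True
          hence "AE x in M. f x = 0" using J(2)
            by (simp add: nn_integral_0_iff_AE)
          hence "AE x in M. ennreal (norm (f x) powr r) \<le> 0" by eventually_elim auto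
          hence "(\<integral>\<^sup>+ x. ennreal (norm (f x) powr r) \<partial>M) \<le> (\<integral>\<^sup>+ x. 0 \<partial>M)"
            by (rule nn_integral_mono_AE)
          thus ?thesis using rs p by (simp add: Lp_norm_ennreal)
        next
          case False
          hence "J > 0" using J by simp
          \<comment> \<open>Weighted AM-GM for \<open>x powr s / J\<close> and 1 with weights r/s
            and 1 - r/s. Both have integral 1 over the space, so the bracket integrates to
            1.\<close>
          have young: "x powr r \<le> J powr (r/s) * (r/s * (x powr s / J) + (1 - r/s))" if "x \<ge> 0" for x
          proof (cases "x = 0")
            case False
            hence "x > 0" using that by simp
            have "(x powr s / J) powr (r/s) * 1 powr (1 - r/s) \<le> r/s * (x powr s / J) + (1 - r/s) * 1"
              using rs \<open>x > 0\<close> \<open>J > 0\<close> by (intro Youngs_inequality_0) auto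
            hence "x powr r / J powr (r/s) \<le> r/s * (x powr s / J) + (1 - r/s)"
              using rs \<open>x > 0\<close> \<open>J > 0\<close> by (simp add: powr_divide powr_powr)
            thus ?thesis using \<open>J > 0\<close> by (simp add: divide_le_eq mult.commute)
          qed (use rs in auto)
          define A where "A = J powr (r/s) * (r/s / J)"
          define B where "B = J powr (r/s) * (1 - r/s)"
          have AB: "A \<ge> 0" "B \<ge> 0" using rs \<open>J > 0\<close> by (simp_all add: A_def B_def)
          have "x powr r \<le> A * x powr s + B" if "x \<ge> 0" for x
            using young[OF that] by (simp add: A_def B_def algebra_simps)
          hence "(\<integral>\<^sup>+ x. ennreal (norm (f x) powr r) \<partial>M) \<le>
            (\<integral>\<^sup>+ x. ennreal A * ennreal (norm (f x) powr s) + ennreal B \<partial>M)"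
            using AB by (intro nn_integral_mono) (simp flip: ennreal_mult' ennreal_plus)
          also have "\<dots> = ennreal A * ennreal J + ennreal B"
            by (simp add: nn_integral_add nn_integral_cmult J emeasure_space_1)
          also have "\<dots> = ennreal (A * J + B)"
            using AB J by (simp add: ennreal_mult')
          also have "A * J + B = (J powr (1/s)) powr r"
            using \<open>J > 0\<close> by (simp add: A_def B_def powr_powr algebra_simps)
          finally show ?thesis using p q J rs by (auto intro!: Lp_norm_leI)
        qed
      qed auto
    qed
  qed
qed

section \<open>The kernel\<close>

definition kern :: "real \<Rightarrow> real \<Rightarrow> real \<Rightarrow> real \<Rightarrow> complex" where
  "kern \<gamma> N t s = exp (\<i> * of_real (N / (1 + t + s))) / of_real ((1 + t + s) powr \<gamma>)"

lemma T_op_kern: "T_op \<gamma> N f t = (LINT s|unit_lebesgue. kern \<gamma> N t s * f s)"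
  by (simp add: T_op_def kern_def)

lemma norm_kern: "cmod (kern \<gamma> N t s) = inverse ((1 + t + s) powr \<gamma>)"
  unfolding kern_def norm_divide norm_exp_i_times by (simp add: divide_inverse)

lemma norm_kern_le_1:
  assumes "\<gamma> \<ge> 0" "t \<ge> 0" "s \<ge> 0"
  shows "cmod (kern \<gamma> N t s) \<le> 1"
  using assms by (simp add: norm_kern ge_one_powr_ge_zero inverse_le_1_iff)

lemma prob_space_unit_lebesgue: "prob_space unit_lebesgue"
  by (rule prob_spaceI) (simp add: emeasure_restrict_space)

interpretation unit: prob_space unit_lebesgue
  by (rule prob_space_unit_lebesgue)

interpretation unit_pair: pair_sigma_finite unit_lebesgue unit_lebesgue ..

interpretation unit_prod: pair_prob_space unit_lebesgue unit_lebesgue ..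

text \<open>The Lebesgue sigma-algebra is finer than the Borel one. As measurability rules, this
  lemma and the next two let Borel functions of Lebesgue variables be treated automatically, also on
  product spaces.\<close>

lemma lebesgue_on_ident_measurable [measurable]: "(\<lambda>x. x) \<in> borel_measurable (lebesgue_on (S :: real set))"
  by (simp add: measurable_completion measurable_restrict_space1)

lemma lebesgue_on_fst_measurable [measurable]:
  "fst \<in> borel_measurable (lebesgue_on (S :: real set) \<Otimes>\<^sub>M M)"
  using measurable_compose[OF measurable_fst lebesgue_on_ident_measurable] by simp

lemma lebesgue_on_snd_measurable [measurable]:
  "snd \<in> borel_measurable (M \<Otimes>\<^sub>M lebesgue_on (S :: real set))"
  using measurable_compose[OF measurable_snd lebesgue_on_ident_measurable] by simp

lemma kern_measurable [measurable (raw)]: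
  assumes [measurable]: "f \<in> borel_measurable M" "g \<in> borel_measurable M"
  shows "(\<lambda>x. kern \<gamma> N (f x) (g x)) \<in> borel_measurable M"
  unfolding kern_def by measurable

text \<open>The set \<open>S\<close> is left free because the L^2 estimate considers the output on
  [-1/2, 3/2] as well as on [0,1].\<close>

lemma T_op_measurable:
  assumes [measurable]: "f \<in> borel_measurable unit_lebesgue"
  shows "T_op \<gamma> N f \<in> borel_measurable (lebesgue_on S)"
proof -
  have "(\<lambda>(t, s). kern \<gamma> N t s * f s) \<in> borel_measurable (lebesgue_on S \<Otimes>\<^sub>M unit_lebesgue)"
    by measurable
  hence "(\<lambda>t. LINT s|unit_lebesgue. kern \<gamma> N t s * f s) \<in> borel_measurable (lebesgue_on S)"
    by (rule unit.borel_measurable_lebesgue_integral)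
  thus ?thesis by (simp add: T_op_kern[abs_def])
qed

lemma integrable_kern_mult:
  assumes f: "integrable unit_lebesgue f" and "\<gamma> \<ge> 0" "t \<ge> 0"
  shows "integrable unit_lebesgue (\<lambda>s. kern \<gamma> N t s * f s)"
proof (rule Bochner_Integration.integrable_bound[OF f])
  have [measurable]: "f \<in> borel_measurable unit_lebesgue" using f by simp
  show "(\<lambda>s. kern \<gamma> N t s * f s) \<in> borel_measurable unit_lebesgue" by measurable
  show "AE s in unit_lebesgue. norm (kern \<gamma> N t s * f s) \<le> norm (f s)"
    using norm_kern_le_1[OF \<open>\<gamma> \<ge> 0\<close> \<open>t \<ge> 0\<close>]
    by (intro AE_I2) (auto simp: norm_mult intro!: mult_left_le_one_le)
qed

lemma norm_T_op_le:
  assumes f: "integrable unit_lebesgue f" and "\<gamma> \<ge> 0" "t \<ge> 0"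
  shows "cmod (T_op \<gamma> N f t) \<le> (LINT s|unit_lebesgue. cmod (f s))"
  unfolding T_op_kern
proof (rule integral_norm_bound[THEN order_trans], rule integral_mono)
  show "integrable unit_lebesgue (\<lambda>s. cmod (kern \<gamma> N t s * f s))"
    using integrable_kern_mult[OF assms] by simp
  show "integrable unit_lebesgue (\<lambda>s. cmod (f s))" using f by simp
  show "cmod (kern \<gamma> N t s * f s) \<le> cmod (f s)" if "s \<in> space unit_lebesgue" for s
    using norm_kern_le_1[OF \<open>\<gamma> \<ge> 0\<close> \<open>t \<ge> 0\<close>, of s N] that
    by (auto simp: norm_mult intro!: mult_left_le_one_le)
qed

section \<open>Cutoff and oscillatory integral in t\<close>

definition cutoff :: "real \<Rightarrow> real" where
  "cutoff t = ((t + 1/2) * (3/2 - t))\<^sup>2"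

text \<open>The base \<open>(t + 1/2) * (3/2 - t)\<close> equals \<open>3/4 + t * (1 - t)\<close>,
  so the cutoff is at least 9/16 on [0,1]; hence the factor 2.\<close>

lemma cutoff_lower: "0 \<le> t \<Longrightarrow> t \<le> 1 \<Longrightarrow> 1 \<le> 2 * cutoff t"
proof -
  assume t: "0 \<le> t" "t \<le> 1"
  have "(3/4)\<^sup>2 \<le> ((t + 1/2) * (3/2 - t))\<^sup>2"
  proof (rule power_mono)
    have "0 \<le> t * (1 - t)" using t by simp
    thus "3/4 \<le> (t + 1/2) * (3/2 - t)" by (simp add: algebra_simps)
  qed simp
  thus ?thesis by (simp add: cutoff_def power2_eq_square)
qed

text \<open>This is ((w m^2/n)' m^2/n)' for the weight w = c^2 m^(-\<gamma>), computed with m' = n,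
  n' = 2, c' = 1 - 2 t: the phase is a multiple of 1/m, with derivative a multiple of n/m^2, so each
  integration by parts replaces w by (w m^2/n)' up to a constant. Keeping m and n as free variables
  makes bounds uniform in s, s' a matter of compactness.\<close>

definition remainder :: "real \<Rightarrow> real \<Rightarrow> real \<Rightarrow> real \<Rightarrow> real" where
  "remainder \<gamma> t m n = (let c = (t + 1/2) * (3/2 - t) in m powr (-\<gamma>) *
     ((2 * (1 - 2 * t)\<^sup>2 - 4 * c) * m^4 / n^2
      + 2 * c * (1 - 2 * t) * ((4 - \<gamma>) * m^3 / n - 4 * m^4 / n^3)
      + 2 * c * (1 - 2 * t) * ((2 - \<gamma>) * m^3 / n - 2 * m^4 / n^3)
      + c\<^sup>2 * (- \<gamma> * ((2 - \<gamma>) * m^2 - 2 * m^3 / n^2) + (2 - \<gamma>) * (3 * m^2 - 2 * m^3 / n^2)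
            - 8 * m^3 / n^2 + 12 * m^4 / n^4)))"

text \<open>Continuity on a compact box. For t in [-1/2, 3/2] and s, s' in [0,1] both factors of m
  lie in [1/2, 7/2], which gives the ranges of m and n. Neither N nor s' - s enters, so the bound
  depends on \<gamma> alone.\<close>

lemma remainder_bounded:
  obtains B where "B > 0"
    "\<And>t m n. t \<in> {-1/2..3/2} \<Longrightarrow> m \<in> {1/4..49/4} \<Longrightarrow> n \<in> {1..7} \<Longrightarrow>
       \<bar>remainder \<gamma> t m n\<bar> \<le> B \<and> \<bar>cutoff t * m powr (-\<gamma>)\<bar> \<le> B"
proof -
  define D where "D = {-1/2..3/2::real} \<times> {1/4..49/4::real} \<times> {1..7::real}"
  have D: "compact D" unfolding D_def by (intro compact_Times compact_Icc)
  have "continuous_on D (\<lambda>x. remainder \<gamma> (fst x) (fst (snd x)) (snd (snd x)))"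
    unfolding remainder_def Let_def D_def by (intro continuous_intros) auto
  hence "bounded ((\<lambda>x. remainder \<gamma> (fst x) (fst (snd x)) (snd (snd x))) ` D)"
    using D compact_continuous_image compact_imp_bounded by blast
  then obtain B1 where B1: "\<And>x. x \<in> D \<Longrightarrow> \<bar>remainder \<gamma> (fst x) (fst (snd x)) (snd (snd x))\<bar> \<le> B1"
    unfolding bounded_real by blast
  have "continuous_on D (\<lambda>x. cutoff (fst x) * (fst (snd x)) powr (-\<gamma>))"
    unfolding cutoff_def D_def by (intro continuous_intros) auto
  hence "bounded ((\<lambda>x. cutoff (fst x) * (fst (snd x)) powr (-\<gamma>)) ` D)"
    using D compact_continuous_image compact_imp_bounded by blast
  then obtain B0 where B0: "\<And>x. x \<in> D \<Longrightarrow> \<bar>cutoff (fst x) * (fst (snd x)) powr (-\<gamma>)\<bar> \<le> B0"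
    unfolding bounded_real by blast
  show ?thesis
  proof (rule that[of "max 1 (max B0 B1)"])
    fix t m n :: real
    assume "t \<in> {-1/2..3/2}" "m \<in> {1/4..49/4}" "n \<in> {1..7}"
    hence "(t, m, n) \<in> D" by (simp add: D_def)
    from B0[OF this] B1[OF this]
    show "\<bar>remainder \<gamma> t m n\<bar> \<le> max 1 (max B0 B1) \<and> \<bar>cutoff t * m powr (-\<gamma>)\<bar> \<le> max 1 (max B0 B1)"
      by auto
  qed simp
qed

text \<open>With \<open>u = 1 + t + s\<close>, \<open>v = 1 + t + s'\<close>, \<open>m = u v\<close>, \<open>n = u + v\<close> the phase of
  \<open>K(t,s) \<cdot> cnj K(t,s')\<close> is \<open>N (s' - s) / m\<close>, and \<open>m' = n\<close>, \<open>n' = 2\<close> in \<open>t\<close>. Two integrations by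
  parts turn the cut-off weight into \<open>remainder\<close>; there is no boundary term since the cutoff
  vanishes to second order.\<close>

lemma oscillatory_antiderivative:
  fixes s s' N \<gamma> :: real
  assumes s: "0 \<le> s" "0 \<le> s'" and t: "t \<ge> -1/2"
  defines "m \<equiv> \<lambda>t. (1 + t + s) * (1 + t + s')" and "n \<equiv> \<lambda>t. (1 + t + s) + (1 + t + s')"
    and "c \<equiv> \<lambda>t::real. (t + 1/2) * (3/2 - t)"
    and "\<beta> \<equiv> - \<i> * of_real (N * (s' - s))"
  defines "E \<equiv> \<lambda>t. exp (\<i> * of_real (N * (s' - s) / m t))"
  defines "h \<equiv> \<lambda>t. (c t)\<^sup>2 * (m t)^2 * m t powr (-\<gamma>) / n t"
    and "k \<equiv> \<lambda>t. 2 * c t * (1 - 2 * t) * (m t)^4 * m t powr (-\<gamma>) / (n t)^2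
           + (c t)\<^sup>2 * m t powr (-\<gamma>) * ((2 - \<gamma>) * (m t)^3 / n t - 2 * (m t)^4 / (n t)^3)"
  shows "((\<lambda>t. E t * (\<beta> * of_real (h t) - of_real (k t))) has_vector_derivative
     (\<beta>\<^sup>2 * (E t * of_real (cutoff t * m t powr (-\<gamma>))) - E t * of_real (remainder \<gamma> t (m t) (n t)))) (at t)"
proof -
  have pos: "1 + t + s > 0" "1 + t + s' > 0" using s t by auto
  hence mp: "m t > 0" and np: "n t > 0" by (auto simp: m_def n_def)
  have dm: "(m has_real_derivative n t) (at t)" unfolding m_def n_def
    by (auto intro!: derivative_eq_intros simp: algebra_simps)
  have dn: "(n has_real_derivative 2) (at t)" unfolding n_def
    by (auto intro!: derivative_eq_intros)
  have dc: "(c has_real_derivative (1 - 2 * t)) (at t)" unfolding c_def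
    by (auto intro!: derivative_eq_intros simp: field_simps)
  define P where "P = (\<lambda>t. m t powr (-\<gamma>))"
  \<comment> \<open>The reciprocal \<open>i\<close> of \<open>n\<close> and \<open>Q = P / m\<close>
    remove all quotients and real powers: the derivative formulas for \<open>h\<close> and
    \<open>k\<close> become polynomial identities modulo n i = 1, which \<open>algebra\<close>
    decides.\<close>
  define i where "i = (\<lambda>t. 1 / n t)"
  define Q where "Q = P t / m t"
  have PQ: "P t = Q * m t" and ni: "n t * i t = 1" using mp np by (simp_all add: Q_def i_def)
  have dP: "(P has_real_derivative (-\<gamma> * Q * n t)) (at t)"
    using mp unfolding P_def Q_def
    by (auto intro!: derivative_eq_intros dm simp: powr_diff field_simps)
  have di: "(i has_real_derivative (- 2 * (i t)\<^sup>2)) (at t)"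
    using np unfolding i_def
    by (auto intro!: derivative_eq_intros dn simp: power2_eq_square field_simps)
  have h: "h = (\<lambda>t. (c t)\<^sup>2 * (m t)^2 * P t * i t)" by (simp add: h_def P_def i_def)
  have k: "k = (\<lambda>t. 2 * c t * (1 - 2 * t) * (m t)^4 * P t * (i t)^2
           + (c t)\<^sup>2 * P t * ((2 - \<gamma>) * (m t)^3 * i t - 2 * (m t)^4 * (i t)^3))"
    by (simp add: k_def P_def i_def power_divide)
  define h' where "h' = 2 * c t * (1 - 2 * t) * (m t)^2 * P t * i t
     + (c t)\<^sup>2 * P t * ((2 - \<gamma>) * m t - 2 * (m t)^2 * (i t)^2)"
  have rem: "remainder \<gamma> t (m t) (n t) = P t *
     ((2 * (1 - 2 * t)\<^sup>2 - 4 * c t) * (m t)^4 * (i t)^2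
      + 2 * c t * (1 - 2 * t) * ((4 - \<gamma>) * (m t)^3 * i t - 4 * (m t)^4 * (i t)^3)
      + 2 * c t * (1 - 2 * t) * ((2 - \<gamma>) * (m t)^3 * i t - 2 * (m t)^4 * (i t)^3)
      + (c t)\<^sup>2 * (- \<gamma> * ((2 - \<gamma>) * (m t)^2 - 2 * (m t)^3 * (i t)^2)
            + (2 - \<gamma>) * (3 * (m t)^2 - 2 * (m t)^3 * (i t)^2)
            - 8 * (m t)^3 * (i t)^2 + 12 * (m t)^4 * (i t)^4))"
    by (simp add: remainder_def Let_def P_def c_def i_def power_divide)
  have dh: "(h has_real_derivative h') (at t)"
    unfolding h
    apply (rule derivative_eq_intros dm di dc dP refl)+
    unfolding h'_def PQ using ni
    apply simp
    apply algebra
    done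
  have dk: "(k has_real_derivative remainder \<gamma> t (m t) (n t)) (at t)"
    unfolding k
    apply (rule derivative_eq_intros dm di dc dP refl)+
    unfolding rem PQ using ni
    apply simp
    apply algebra
    done
  \<comment> \<open>The derivative of E (\<beta> h - k) contains \<beta> E h' - \<beta> E k n/m^2,
    which vanishes by this identity. The next one turns the leading term \<beta>^2 E h n/m^2 into
    \<beta>^2 times the weighted phase.\<close>
  have kh: "k t = h' * (m t)\<^sup>2 / n t"
    using np unfolding k h'_def by (simp add: i_def field_simps power2_eq_square power3_eq_cube power4_eq_xxxx)
  have hw: "h t = cutoff t * m t powr (-\<gamma>) * (m t)\<^sup>2 / n t"
    by (simp add: h_def cutoff_def c_def)
  have dph: "((\<lambda>t. \<i> * of_real (N * (s' - s) / m t)) has_vector_derivative \<beta> * of_real (n t / (m t)\<^sup>2)) (at t)"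
  proof -
    have "((\<lambda>t. N * (s' - s) / m t) has_real_derivative - (N * (s' - s) * n t / (m t)\<^sup>2)) (at t)"
      by (rule derivative_eq_intros dm refl)+ (use mp in \<open>simp_all add: power2_eq_square\<close>)
    hence "((\<lambda>t. \<i> * of_real (N * (s' - s) / m t)) has_vector_derivative
        \<i> * of_real (- (N * (s' - s) * n t / (m t)\<^sup>2))) (at t)"
      by (intro has_vector_derivative_mult_right has_vector_derivative_of_real)
        (simp add: has_real_derivative_iff_has_vector_derivative)
    thus ?thesis by (simp add: \<beta>_def mult.assoc)
  qed
  have dE: "(E has_vector_derivative (\<beta> * of_real (n t / (m t)\<^sup>2)) * E t) (at t)"
    using field_vector_diff_chain_at[OF dph, of exp "E t"] DERIV_exp
    by (simp add: E_def o_def)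
  have dhk: "((\<lambda>t. \<beta> * of_real (h t) - of_real (k t)) has_vector_derivative
      (\<beta> * of_real h' - of_real (remainder \<gamma> t (m t) (n t)))) (at t)"
    using dh dk by (intro has_vector_derivative_diff has_vector_derivative_mult_right has_vector_derivative_of_real)
      (simp_all add: has_real_derivative_iff_has_vector_derivative)
  have nz: "complex_of_real (m t) \<noteq> 0" "complex_of_real (n t) \<noteq> 0" using mp np by auto
  show ?thesis
    using has_vector_derivative_mult[OF dE dhk]
    apply (rule has_vector_derivative_eq_rhs)
    unfolding kh hw using nz
    apply (simp add: field_simps power2_eq_square)
    done
qed

abbreviation cutoff_lebesgue :: "real measure" where
  "cutoff_lebesgue \<equiv> lebesgue_on {-1/2..3/2}"

text \<open>Integrated over t it is the kernel, at (s', s), of T^* \<chi> T, where \<chi> is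
  multiplication by the cutoff and T f is considered on [-1/2, 3/2].\<close>

definition cross :: "real \<Rightarrow> real \<Rightarrow> real \<Rightarrow> real \<Rightarrow> real \<Rightarrow> complex" where
  "cross \<gamma> N t s s' = of_real (cutoff t) * (kern \<gamma> N t s * cnj (kern \<gamma> N t s'))"

lemma cross_eq:
  assumes "s \<in> {0..1}" "s' \<in> {0..1}" "t \<in> {-1/2..3/2}"
  shows "cross \<gamma> N t s s' = exp (\<i> * of_real (N * (s' - s) / ((1 + t + s) * (1 + t + s')))) *
           of_real (cutoff t * ((1 + t + s) * (1 + t + s')) powr (-\<gamma>))"
proof -
  have pos: "1 + t + s > 0" "1 + t + s' > 0" using assms by auto
  have "N / (1 + t + s) - N / (1 + t + s') = N * (s' - s) / ((1 + t + s) * (1 + t + s'))"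
    using pos by (simp add: field_simps)
  hence "exp (\<i> * of_real (N * (s' - s) / ((1 + t + s) * (1 + t + s')))) =
      exp (\<i> * of_real (N / (1 + t + s)) + - (\<i> * of_real (N / (1 + t + s'))))"
    by (metis (no_types, lifting) diff_conv_add_uminus of_real_diff right_diff_distrib)
  hence e: "exp (\<i> * of_real (N * (s' - s) / ((1 + t + s) * (1 + t + s')))) =
      exp (\<i> * of_real (N / (1 + t + s))) * cnj (exp (\<i> * of_real (N / (1 + t + s'))))"
    unfolding exp_add by (simp add: exp_cnj del: of_real_divide)
  have "((1 + t + s) * (1 + t + s')) powr (-\<gamma>) = 1 / ((1 + t + s) powr \<gamma> * (1 + t + s') powr \<gamma>)"
    using pos by (simp only: powr_mult powr_minus) (simp add: divide_inverse)
  thus ?thesis unfolding e cross_def kern_def by simp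
qed

text \<open>Let X be the integral and a = N (s' - s). The trivial bound |X| \<le> 2 B and the bound
  a^2 |X| \<le> 2 B from integration by parts add up to (1 + a^2) |X| \<le> 4 B, with no distinction
  between small and large a.\<close>

lemma integral_cross_bound:
  obtains B where "B > 0"
    "\<And>N s s'. s \<in> {0..1} \<Longrightarrow> s' \<in> {0..1} \<Longrightarrow>
      cmod (LINT t|cutoff_lebesgue. cross \<gamma> N t s s') \<le> B / (1 + (N * (s' - s))\<^sup>2)"
proof -
  obtain B where B: "B > 0"
    "\<And>t m n. t \<in> {-1/2..3/2} \<Longrightarrow> m \<in> {1/4..49/4} \<Longrightarrow> n \<in> {1..7} \<Longrightarrow>
       \<bar>remainder \<gamma> t m n\<bar> \<le> B \<and> \<bar>cutoff t * m powr (-\<gamma>)\<bar> \<le> B"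
    using remainder_bounded by metis
  show ?thesis
  proof (rule that[of "4 * B"])
    show "4 * B > 0" using B by simp
    fix N s s' :: real assume s: "s \<in> {0..1}" "s' \<in> {0..1}"
    define m where "m = (\<lambda>t. (1 + t + s) * (1 + t + s'))"
    define n where "n = (\<lambda>t. (1 + t + s) + (1 + t + s'))"
    define E where "E = (\<lambda>t. exp (\<i> * of_real (N * (s' - s) / m t)))"
    define \<beta> where "\<beta> = - \<i> * complex_of_real (N * (s' - s))"
    define w where "w = (\<lambda>t. E t * of_real (cutoff t * m t powr (-\<gamma>)))"
    define r where "r = (\<lambda>t. E t * of_real (remainder \<gamma> t (m t) (n t)))"
    have mn: "m t \<in> {1/4..49/4}" "n t \<in> {1..7}" if "t \<in> {-1/2..3/2}" for t
    proof -
      have "1/2 * (1/2) \<le> m t" unfolding m_def using s that by (intro mult_mono) auto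
      moreover have "m t \<le> 7/2 * (7/2)" unfolding m_def using s that by (intro mult_mono) auto
      ultimately show "m t \<in> {1/4..49/4}" by simp
      show "n t \<in> {1..7}" using s that by (auto simp: n_def)
    qed
    have wB: "cmod (w t) \<le> B" and rB: "cmod (r t) \<le> B" if "t \<in> {-1/2..3/2}" for t
      using B(2)[OF that mn[OF that]]
      unfolding w_def r_def E_def norm_mult norm_exp_i_times norm_of_real by auto
    have eq: "cross \<gamma> N t s s' = w t" if "t \<in> {-1/2..3/2}" for t
      using cross_eq[OF s that] by (simp add: w_def E_def m_def)
    have meas: "w \<in> borel_measurable cutoff_lebesgue" "r \<in> borel_measurable cutoff_lebesgue"
      unfolding w_def r_def E_def m_def n_def cutoff_def remainder_def Let_def by measurable
    interpret W: finite_measure cutoff_lebesgue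
      by (rule finite_measureI) (simp add: emeasure_restrict_space)
    have "integrable cutoff_lebesgue w"
      by (rule W.integrable_const_bound[where B = B]) (use wB meas in \<open>auto intro!: AE_I2\<close>)
    moreover have "integrable cutoff_lebesgue r"
      by (rule W.integrable_const_bound[where B = B]) (use rB meas in \<open>auto intro!: AE_I2\<close>)
    ultimately have int: "integrable cutoff_lebesgue w" "integrable cutoff_lebesgue r" .
    have le: "cmod (integral\<^sup>L cutoff_lebesgue f) \<le> 2 * B"
      if "integrable cutoff_lebesgue f" "\<And>t. t \<in> {-1/2..3/2} \<Longrightarrow> cmod (f t) \<le> B" for f :: "real \<Rightarrow> complex"
    proof -
      have "cmod (integral\<^sup>L cutoff_lebesgue f) \<le> (LINT t|cutoff_lebesgue. cmod (f t))"
        by (rule integral_norm_bound)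
      also have "\<dots> \<le> (LINT t|cutoff_lebesgue. B)"
        using that by (intro integral_mono) auto
      also have "\<dots> = 2 * B" by (simp add: measure_restrict_space)
      finally show ?thesis .
    qed
    define G where "G = (\<lambda>t. E t * (\<beta> * of_real (((t + 1/2) * (3/2 - t))\<^sup>2 * (m t)^2 * m t powr (-\<gamma>) / n t)
        - of_real (2 * ((t + 1/2) * (3/2 - t)) * (1 - 2 * t) * (m t)^4 * m t powr (-\<gamma>) / (n t)^2
           + ((t + 1/2) * (3/2 - t))\<^sup>2 * m t powr (-\<gamma>) * ((2 - \<gamma>) * (m t)^3 / n t - 2 * (m t)^4 / (n t)^3))))"
    have "((\<lambda>t. \<beta>\<^sup>2 * w t - r t) has_integral (G (3/2) - G (-1/2))) {-1/2..3/2}"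
    proof (rule fundamental_theorem_of_calculus)
      fix t :: real assume t: "t \<in> {-1/2..3/2}"
      have "(G has_vector_derivative (\<beta>\<^sup>2 * w t - r t)) (at t)"
        using oscillatory_antiderivative[of s s' t N \<gamma>] s t
        unfolding G_def w_def r_def E_def m_def n_def \<beta>_def by simp
      thus "(G has_vector_derivative (\<beta>\<^sup>2 * w t - r t)) (at t within {-1/2..3/2})"
        by (rule has_vector_derivative_at_within)
    qed simp
    \<comment> \<open>In the second part of \<open>G\<close> the squared factor (t + 1/2) (3/2 - t)
      has been differentiated once, and one power of it survives. A simple zero of the cutoff would
      leave a boundary term here.\<close>
    moreover have "G (3/2) = 0" "G (-1/2) = 0" by (simp_all add: G_def)
    ultimately have "integral {-1/2..3/2} (\<lambda>t. \<beta>\<^sup>2 * w t - r t) = 0"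
      by (simp add: integral_unique)
    moreover have "integral\<^sup>L cutoff_lebesgue (\<lambda>t. \<beta>\<^sup>2 * w t - r t) = integral {-1/2..3/2} (\<lambda>t. \<beta>\<^sup>2 * w t - r t)"
      using int by (intro lebesgue_integral_eq_integral) auto
    ultimately have "\<beta>\<^sup>2 * integral\<^sup>L cutoff_lebesgue w = integral\<^sup>L cutoff_lebesgue r"
      using int by simp
    hence "cmod (\<beta>\<^sup>2) * cmod (integral\<^sup>L cutoff_lebesgue w) \<le> 2 * B"
      using le[OF int(2) rB] by (metis norm_mult)
    moreover have "cmod (\<beta>\<^sup>2) = (N * (s' - s))\<^sup>2"
      by (simp add: \<beta>_def norm_power norm_mult power_mult_distrib flip: of_real_diff)
    ultimately have "(1 + (N * (s' - s))\<^sup>2) * cmod (integral\<^sup>L cutoff_lebesgue w) \<le> 4 * B"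
      using le[OF int(1) wB] by (simp add: algebra_simps)
    moreover have "1 + (N * (s' - s))\<^sup>2 > 0" by (simp add: add_pos_nonneg)
    ultimately have "cmod (integral\<^sup>L cutoff_lebesgue w) \<le> 4 * B / (1 + (N * (s' - s))\<^sup>2)"
      by (simp add: field_simps)
    moreover have "(LINT t|cutoff_lebesgue. cross \<gamma> N t s s') = integral\<^sup>L cutoff_lebesgue w"
      by (rule Bochner_Integration.integral_cong) (auto simp: eq)
    ultimately show "cmod (LINT t|cutoff_lebesgue. cross \<gamma> N t s s') \<le> 4 * B / (1 + (N * (s' - s))\<^sup>2)"
      by simp
  qed
qed

lemma nn_integral_lebesgue_on:
  assumes "S \<in> sets borel" and [measurable]: "f \<in> borel_measurable borel"
  shows "(\<integral>\<^sup>+ x. f x \<partial>lebesgue_on S) = (\<integral>\<^sup>+ x. f x * indicator S x \<partial>lborel)"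
proof -
  have [measurable]: "S \<in> sets borel" by fact
  show ?thesis by (simp add: nn_integral_restrict_space nn_integral_completion)
qed

text \<open>The primitive arctan (N (s' - s)) / N varies by less than 4/N, and 4/N \<le> 8/(1 + N)
  for N \<ge> 1. For N \<le> 1 the bound 1 on the integrand is enough.\<close>

lemma schur_kernel_bound:
  assumes "N \<ge> 0" "s \<in> {0..1}"
  shows "(\<integral>\<^sup>+ s'. ennreal (1 / (1 + (N * (s' - s))\<^sup>2)) \<partial>unit_lebesgue) \<le> ennreal (8 / (1 + N))"
proof (cases "N \<le> 1")
  case True
  have le1: "1 / (1 + y) \<le> 1" if "y \<ge> 0" for y :: real using that by simp
  have "(\<integral>\<^sup>+ s'. ennreal (1 / (1 + (N * (s' - s))\<^sup>2)) \<partial>unit_lebesgue) \<le> (\<integral>\<^sup>+ s'. ennreal 1 \<partial>unit_lebesgue)"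
    by (intro nn_integral_mono ennreal_leI le1 zero_le_power2)
  also have "\<dots> = ennreal 1" by (simp add: emeasure_restrict_space)
  also have "\<dots> \<le> ennreal (8 / (1 + N))" using True assms by (intro ennreal_leI) simp
  finally show ?thesis .
next
  case False
  have "(\<integral>\<^sup>+ s'. ennreal (1 / (1 + (N * (s' - s))\<^sup>2)) \<partial>unit_lebesgue) =
      (\<integral>\<^sup>+ s'. ennreal (1 / (1 + (N * (s' - s))\<^sup>2)) * indicator {0..1} s' \<partial>lborel)"
    by (rule nn_integral_lebesgue_on) auto
  also have "\<dots> = ennreal (arctan (N * (1 - s)) / N - arctan (N * (0 - s)) / N)"
  proof (rule nn_integral_FTC_Icc)
    fix x :: real
    show "((\<lambda>x. arctan (N * (x - s)) / N) has_real_derivative 1 / (1 + (N * (x - s))\<^sup>2)) (at x)"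
      using False by (auto intro!: derivative_eq_intros simp: divide_inverse)
  qed (auto simp: add_nonneg_nonneg)
  also have "\<dots> \<le> ennreal (8 / (1 + N))"
  proof (rule ennreal_leI)
    have "arctan (N * (1 - s)) - arctan (N * (0 - s)) \<le> 4"
      using arctan_bounded[of "N * (1 - s)"] arctan_bounded[of "N * (0 - s)"] pi_less_4 by linarith
    hence "arctan (N * (1 - s)) / N - arctan (N * (0 - s)) / N \<le> 4 / N"
      using False by (simp add: divide_right_mono flip: diff_divide_distrib)
    also have "\<dots> \<le> 8 / (1 + N)" using False by (simp add: field_simps)
    finally show "arctan (N * (1 - s)) / N - arctan (N * (0 - s)) / N \<le> 8 / (1 + N)" .
  qed
  finally show ?thesis .
qed

section \<open>The bound on L2\<close>

lemma borel_measurable_cnj [measurable (raw)]: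
  "f \<in> borel_measurable M \<Longrightarrow> (\<lambda>x. cnj (f x)) \<in> borel_measurable M"
  by (rule measurable_compose[of f M borel cnj]) (auto intro!: borel_measurable_continuous_onI continuous_intros)

text \<open>The square of the modulus is opened into a double integral over (s, s'), so that
  afterwards the integral in t, which carries the oscillation, can be taken first.\<close>

lemma T_op_cross:
  assumes [measurable]: "f \<in> borel_measurable unit_lebesgue"
    and int: "integrable (unit_lebesgue \<Otimes>\<^sub>M unit_lebesgue)
      (\<lambda>z. cross \<gamma> N t (fst z) (snd z) * (f (fst z) * cnj (f (snd z))))"
  shows "of_real (cutoff t * (cmod (T_op \<gamma> N f t))\<^sup>2) =
    (LINT z|(unit_lebesgue \<Otimes>\<^sub>M unit_lebesgue). cross \<gamma> N t (fst z) (snd z) * (f (fst z) * cnj (f (snd z))))"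
proof -
  have "(LINT z|(unit_lebesgue \<Otimes>\<^sub>M unit_lebesgue). cross \<gamma> N t (fst z) (snd z) * (f (fst z) * cnj (f (snd z)))) =
     (LINT s|unit_lebesgue. LINT s'|unit_lebesgue. cross \<gamma> N t s s' * (f s * cnj (f s')))"
    using unit_pair.integral_fst'[OF int] by simp
  also have "\<dots> = (LINT s|unit_lebesgue. LINT s'|unit_lebesgue.
      (of_real (cutoff t) * (kern \<gamma> N t s * f s)) * cnj (kern \<gamma> N t s' * f s'))"
    by (simp add: cross_def ac_simps)
  also have "\<dots> = (LINT s|unit_lebesgue. (of_real (cutoff t) * (kern \<gamma> N t s * f s)) * cnj (T_op \<gamma> N f t))"
    unfolding integral_mult_right_zero Bochner_Integration.integral_cnj T_op_kern ..
  also have "\<dots> = of_real (cutoff t) * (T_op \<gamma> N f t * cnj (T_op \<gamma> N f t))"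
    unfolding integral_mult_left_zero integral_mult_right_zero T_op_kern by (simp only: mult.assoc)
  also have "\<dots> = of_real (cutoff t * (cmod (T_op \<gamma> N f t))\<^sup>2)"
    by (simp only: of_real_mult complex_norm_square)
  finally show ?thesis by simp
qed

lemma cutoff_le_1:
  assumes "t \<in> {-1/2..3/2}"
  shows "0 \<le> cutoff t" "cutoff t \<le> 1"
proof -
  have "(t + 1/2) * (3/2 - t) \<ge> 0" using assms by simp
  moreover have "(t + 1/2) * (3/2 - t) \<le> 1"
    using zero_le_power2[of "t - 1/2"] by (simp add: power2_eq_square algebra_simps)
  ultimately show "cutoff t \<le> 1" unfolding cutoff_def by (rule power_le_one)
qed (simp add: cutoff_def)

lemma norm_kern_cutoff:
  assumes "\<gamma> \<ge> 0" "t \<in> {-1/2..3/2}" "s \<in> {0..1}"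
  shows "cmod (kern \<gamma> N t s) \<le> 2 powr \<gamma>"
proof -
  have "(1/2) powr \<gamma> \<le> (1 + t + s) powr \<gamma>" using assms by (intro powr_mono2) auto
  hence "inverse ((1 + t + s) powr \<gamma>) \<le> inverse ((1/2) powr \<gamma>)"
    by (intro le_imp_inverse_le) auto
  thus ?thesis by (simp add: norm_kern powr_divide)
qed

lemma norm_cross_le:
  assumes "\<gamma> \<ge> 0" "t \<in> {-1/2..3/2}" "s \<in> {0..1}" "s' \<in> {0..1}"
  shows "cmod (cross \<gamma> N t s s') \<le> (2 powr \<gamma>)\<^sup>2"
proof -
  have "cmod (cross \<gamma> N t s s') \<le> 1 * (2 powr \<gamma> * 2 powr \<gamma>)"
    unfolding cross_def norm_mult complex_mod_cnj norm_of_real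
    using cutoff_le_1[OF assms(2)] assms by (intro mult_mono norm_kern_cutoff) auto
  thus ?thesis by (simp add: power2_eq_square)
qed

text \<open>The bound \<open>K\<close> does not enter the constant. Boundedness of \<open>f\<close>
  makes the triple integrand bounded on a space of finite measure, which justifies Fubini.\<close>

lemma T_op_L2_bound:
  assumes \<gamma>: "\<gamma> \<ge> 0"
  obtains A where "A > 0"
    "\<And>N f K. N \<ge> 0 \<Longrightarrow> f \<in> borel_measurable unit_lebesgue \<Longrightarrow> (\<And>s. s \<in> {0..1} \<Longrightarrow> cmod (f s) \<le> K) \<Longrightarrow>
      (\<integral>\<^sup>+ t. ennreal ((cmod (T_op \<gamma> N f t))\<^sup>2) \<partial>unit_lebesgue)
        \<le> ennreal (A / (1 + N)) * (\<integral>\<^sup>+ s. ennreal ((cmod (f s))\<^sup>2) \<partial>unit_lebesgue)"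
proof -
  obtain B where B: "B > 0" "\<And>N s s'. s \<in> {0..1} \<Longrightarrow> s' \<in> {0..1} \<Longrightarrow>
      cmod (LINT t|cutoff_lebesgue. cross \<gamma> N t s s') \<le> B / (1 + (N * (s' - s))\<^sup>2)"
    using integral_cross_bound by metis
  show ?thesis
  proof (rule that[of "16 * B"])
    show "16 * B > 0" using B by simp
    fix N K :: real and f :: "real \<Rightarrow> complex"
    assume N: "N \<ge> 0" and fm[measurable]: "f \<in> borel_measurable unit_lebesgue"
      and K: "\<And>s. s \<in> {0..1} \<Longrightarrow> cmod (f s) \<le> K"
    let ?M = "unit_lebesgue" and ?W = "cutoff_lebesgue"
    let ?T = "T_op \<gamma> N f"
    interpret W: finite_measure ?W by (rule finite_measureI) (simp add: emeasure_restrict_space)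
    interpret P: finite_measure "?W \<Otimes>\<^sub>M (?M \<Otimes>\<^sub>M ?M)"
      by (intro finite_measure_pair_measure W.finite_measure_axioms unit_prod.finite_measure_axioms)
    interpret WP: pair_sigma_finite ?W "?M \<Otimes>\<^sub>M ?M" ..
    have K0: "K \<ge> 0" using order_trans[OF norm_ge_zero K[of 0]] by simp
    define F where "F = (\<lambda>t z. cross \<gamma> N t (fst z) (snd z) * (f (fst z) * cnj (f (snd z))))"
    define C where "C = (2 powr \<gamma>)\<^sup>2 * (K * K)"
    have FC: "cmod (F t z) \<le> C" if "t \<in> {-1/2..3/2}" "fst z \<in> {0..1}" "snd z \<in> {0..1}" for t z
      unfolding F_def C_def norm_mult complex_mod_cnj
      using that K K0 by (intro mult_mono norm_cross_le \<gamma>) auto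
    have Fm[measurable]: "case_prod F \<in> borel_measurable (?W \<Otimes>\<^sub>M (?M \<Otimes>\<^sub>M ?M))"
    proof -
      let ?P = "?W \<Otimes>\<^sub>M (?M \<Otimes>\<^sub>M ?M)"
      have [measurable]: "(\<lambda>x. fst x) \<in> borel_measurable ?P" by (rule lebesgue_on_fst_measurable)
      have s1: "(\<lambda>x. fst (snd x)) \<in> borel_measurable ?P"
        by (rule measurable_compose[OF measurable_snd lebesgue_on_fst_measurable])
      have s2: "(\<lambda>x. snd (snd x)) \<in> borel_measurable ?P"
        by (rule measurable_compose[OF measurable_snd lebesgue_on_snd_measurable])
      have [measurable]: "(\<lambda>x. cutoff (fst x)) \<in> borel_measurable ?P"
        by (rule measurable_compose[OF lebesgue_on_fst_measurable]) (simp add: cutoff_def[abs_def])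
      have "(\<lambda>x. complex_of_real (cutoff (fst x))) \<in> borel_measurable ?P" by measurable
      moreover have "(\<lambda>x. f (fst (snd x))) \<in> borel_measurable ?P"
        by (intro measurable_compose[OF _ fm] measurable_compose[OF measurable_snd] measurable_fst)
      moreover have "(\<lambda>x. f (snd (snd x))) \<in> borel_measurable ?P"
        by (intro measurable_compose[OF _ fm] measurable_compose[OF measurable_snd] measurable_snd)
      ultimately show ?thesis
        unfolding F_def cross_def case_prod_beta'
        by (intro borel_measurable_times borel_measurable_cnj kern_measurable s1 s2 lebesgue_on_fst_measurable)
    qed
    have Fint: "integrable (?W \<Otimes>\<^sub>M (?M \<Otimes>\<^sub>M ?M)) (case_prod F)"
      by (rule P.integrable_const_bound[where B = C, OF _ Fm])
        (use FC in \<open>auto intro!: AE_I2 simp: space_pair_measure\<close>)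
    have Ftint: "integrable (?M \<Otimes>\<^sub>M ?M) (F t)" if "t \<in> {-1/2..3/2}" for t
    proof (rule unit_prod.integrable_const_bound[where B = C])
      show "AE z in ?M \<Otimes>\<^sub>M ?M. cmod (F t z) \<le> C"
        using FC that by (auto intro!: AE_I2 simp: space_pair_measure)
      show "F t \<in> borel_measurable (?M \<Otimes>\<^sub>M ?M)"
        using measurable_Pair2[OF Fm, of t] that by simp
    qed
    have Tm[measurable]: "?T \<in> borel_measurable (lebesgue_on S)" for S
      by (rule T_op_measurable) fact
    have cm[measurable]: "cutoff \<in> borel_measurable ?W"
      unfolding cutoff_def[abs_def] by measurable
    have key: "of_real (cutoff t * (cmod (?T t))\<^sup>2) = integral\<^sup>L (?M \<Otimes>\<^sub>M ?M) (F t)"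
      if "t \<in> {-1/2..3/2}" for t
      using T_op_cross[of f \<gamma> N t] Ftint[OF that] by (simp add: F_def)
    define Y where "Y = (LINT t|?W. cutoff t * (cmod (?T t))\<^sup>2)"
    have Yint: "integrable ?W (\<lambda>t. cutoff t * (cmod (?T t))\<^sup>2)"
    proof (rule W.integrable_const_bound[where B = C])
      show "AE t in ?W. norm (cutoff t * (cmod (?T t))\<^sup>2) \<le> C"
      proof (rule AE_I2)
        fix t assume "t \<in> space ?W"
        hence t: "t \<in> {-1/2..3/2}" by simp
        have "norm (cutoff t * (cmod (?T t))\<^sup>2) = cmod (of_real (cutoff t * (cmod (?T t))\<^sup>2))"
          by (simp only: norm_of_real real_norm_def)
        also have "\<dots> = cmod (integral\<^sup>L (?M \<Otimes>\<^sub>M ?M) (F t))"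
          using key[OF t] by simp
        also have "\<dots> \<le> (LINT z|(?M \<Otimes>\<^sub>M ?M). cmod (F t z))" by (rule integral_norm_bound)
        also have "\<dots> \<le> (LINT z|(?M \<Otimes>\<^sub>M ?M). C)"
          using Ftint[OF t] FC[OF t] by (intro integral_mono) (auto simp: space_pair_measure)
        also have "\<dots> = C" by (simp add: unit_prod.prob_space)
        finally show "norm (cutoff t * (cmod (?T t))\<^sup>2) \<le> C" .
      qed
    qed measurable
    have "complex_of_real Y = (LINT t|?W. of_real (cutoff t * (cmod (?T t))\<^sup>2))"
      by (simp only: Y_def integral_complex_of_real)
    also have "\<dots> = (LINT t|?W. LINT z|(?M \<Otimes>\<^sub>M ?M). F t z)"
      by (rule Bochner_Integration.integral_cong) (use key in auto)
    also have "\<dots> = (LINT z|(?M \<Otimes>\<^sub>M ?M). LINT t|?W. F t z)"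
      using WP.Fubini_integral[of F] Fint by simp
    finally have Y: "complex_of_real Y = (LINT z|(?M \<Otimes>\<^sub>M ?M). LINT t|?W. F t z)" .
    define H where "H = (\<lambda>s s'::real. 1 / (1 + (N * (s' - s))\<^sup>2))"
    have H0: "H s s' \<ge> 0" for s s' by (simp add: H_def add_nonneg_nonneg)
    have Hsym: "H s s' = H s' s" for s s'
    proof -
      have "(N * (s' - s))\<^sup>2 = (N * (s - s'))\<^sup>2" by (simp add: power2_eq_square algebra_simps)
      thus ?thesis by (simp add: H_def)
    qed
    have Hm[measurable]: "(\<lambda>z. H (fst z) (snd z)) \<in> borel_measurable (?M \<Otimes>\<^sub>M ?M)"
      unfolding H_def by measurable
    \<comment> \<open>Schur's test in symmetric form: |f(s) f(s')| is at most half the sum of the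
      squares, and each square is then integrated against \<open>H\<close> in the other
      variable.\<close>
    have pt: "cmod (LINT t|?W. F t z) \<le>
        B/2 * ((cmod (f (fst z)))\<^sup>2 * H (fst z) (snd z)) + B/2 * ((cmod (f (snd z)))\<^sup>2 * H (fst z) (snd z))"
      if "z \<in> space (?M \<Otimes>\<^sub>M ?M)" for z
    proof -
      have z: "fst z \<in> {0..1}" "snd z \<in> {0..1}" using that by (auto simp: space_pair_measure)
      have "cmod (LINT t|?W. F t z) =
        cmod (LINT t|?W. cross \<gamma> N t (fst z) (snd z)) * (cmod (f (fst z)) * cmod (f (snd z)))"
        by (simp add: F_def norm_mult)
      also have "\<dots> \<le> (B * H (fst z) (snd z)) * (((cmod (f (fst z)))\<^sup>2 + (cmod (f (snd z)))\<^sup>2) / 2)"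
      proof (rule mult_mono)
        show "cmod (LINT t|?W. cross \<gamma> N t (fst z) (snd z)) \<le> B * H (fst z) (snd z)"
          using B(2)[OF z] by (simp add: H_def)
        show "cmod (f (fst z)) * cmod (f (snd z)) \<le> ((cmod (f (fst z)))\<^sup>2 + (cmod (f (snd z)))\<^sup>2) / 2"
          using sum_squares_bound[of "cmod (f (fst z))" "cmod (f (snd z))"] by simp
      qed (use B H0 in auto)
      finally show ?thesis by (simp add: algebra_simps add_divide_distrib)
    qed
    define I where "I = (\<integral>\<^sup>+ s. ennreal ((cmod (f s))\<^sup>2) \<partial>?M)"
    have schur: "(\<integral>\<^sup>+ s'. ennreal (H s s') \<partial>?M) \<le> ennreal (8 / (1 + N))" if "s \<in> space ?M" for s
      using schur_kernel_bound[OF N, of s] that by (simp add: H_def)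
    have half: "(\<integral>\<^sup>+ s. \<integral>\<^sup>+ s'. ennreal ((cmod (f s))\<^sup>2 * H s s') \<partial>?M \<partial>?M) \<le> ennreal (8 / (1 + N)) * I"
    proof -
      have [measurable]: "(\<lambda>s'. H s s') \<in> borel_measurable ?M" for s
        unfolding H_def by measurable
      have "(\<integral>\<^sup>+ s. \<integral>\<^sup>+ s'. ennreal ((cmod (f s))\<^sup>2 * H s s') \<partial>?M \<partial>?M) =
          (\<integral>\<^sup>+ s. ennreal ((cmod (f s))\<^sup>2) * (\<integral>\<^sup>+ s'. ennreal (H s s') \<partial>?M) \<partial>?M)"
        by (simp add: ennreal_mult' H0 nn_integral_cmult)
      also have "\<dots> \<le> (\<integral>\<^sup>+ s. ennreal ((cmod (f s))\<^sup>2) * ennreal (8 / (1 + N)) \<partial>?M)"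
        by (intro nn_integral_mono mult_left_mono schur) auto
      also have "\<dots> = ennreal (8 / (1 + N)) * I"
        by (simp add: I_def nn_integral_multc mult.commute)
      finally show ?thesis .
    qed
    have int1: "(\<integral>\<^sup>+ z. ennreal ((cmod (f (fst z)))\<^sup>2 * H (fst z) (snd z)) \<partial>(?M \<Otimes>\<^sub>M ?M)) \<le> ennreal (8 / (1 + N)) * I"
      using half by (subst unit.nn_integral_fst[symmetric]) simp_all
    have int2: "(\<integral>\<^sup>+ z. ennreal ((cmod (f (snd z)))\<^sup>2 * H (fst z) (snd z)) \<partial>(?M \<Otimes>\<^sub>M ?M)) \<le> ennreal (8 / (1 + N)) * I"
    proof -
      have "(\<integral>\<^sup>+ z. ennreal ((cmod (f (snd z)))\<^sup>2 * H (fst z) (snd z)) \<partial>(?M \<Otimes>\<^sub>M ?M)) =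
        (\<integral>\<^sup>+ s'. \<integral>\<^sup>+ s. ennreal ((cmod (f s'))\<^sup>2 * H s s') \<partial>?M \<partial>?M)"
        using unit_pair.nn_integral_snd[of "\<lambda>z. ennreal ((cmod (f (snd z)))\<^sup>2 * H (fst z) (snd z))"] by simp
      also have "\<dots> = (\<integral>\<^sup>+ s'. \<integral>\<^sup>+ s. ennreal ((cmod (f s'))\<^sup>2 * H s' s) \<partial>?M \<partial>?M)"
        by (subst Hsym) (rule refl)
      finally show ?thesis using half by simp
    qed
    have "ennreal Y \<le> ennreal (cmod (complex_of_real Y))" by (intro ennreal_leI) simp
    also have "\<dots> \<le> (\<integral>\<^sup>+ z. ennreal (cmod (LINT t|?W. F t z)) \<partial>(?M \<Otimes>\<^sub>M ?M))"
      unfolding Y using WP.integrable_snd[OF Fint] by (intro integral_norm_bound_ennreal) simp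
    also have "\<dots> \<le> (\<integral>\<^sup>+ z. ennreal (B/2) * ennreal ((cmod (f (fst z)))\<^sup>2 * H (fst z) (snd z))
        + ennreal (B/2) * ennreal ((cmod (f (snd z)))\<^sup>2 * H (fst z) (snd z)) \<partial>(?M \<Otimes>\<^sub>M ?M))"
    proof (rule nn_integral_mono)
      fix z assume "z \<in> space (?M \<Otimes>\<^sub>M ?M)"
      have e: "ennreal (B/2) * ennreal x = ennreal (B/2 * x)" for x
        by (rule ennreal_mult'[symmetric]) (use B in simp)
      from ennreal_leI[OF pt[OF \<open>z \<in> _\<close>]]
      show "ennreal (cmod (LINT t|?W. F t z)) \<le> ennreal (B/2) * ennreal ((cmod (f (fst z)))\<^sup>2 * H (fst z) (snd z))
        + ennreal (B/2) * ennreal ((cmod (f (snd z)))\<^sup>2 * H (fst z) (snd z))"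
        unfolding e by (subst ennreal_plus[symmetric]) (use B H0 in auto)
    qed
    also have "\<dots> = ennreal (B/2) * (\<integral>\<^sup>+ z. ennreal ((cmod (f (fst z)))\<^sup>2 * H (fst z) (snd z)) \<partial>(?M \<Otimes>\<^sub>M ?M))
        + ennreal (B/2) * (\<integral>\<^sup>+ z. ennreal ((cmod (f (snd z)))\<^sup>2 * H (fst z) (snd z)) \<partial>(?M \<Otimes>\<^sub>M ?M))"
      by (simp add: nn_integral_add nn_integral_cmult)
    also have "\<dots> \<le> ennreal (B/2) * (ennreal (8 / (1 + N)) * I) + ennreal (B/2) * (ennreal (8 / (1 + N)) * I)"
      by (intro add_mono mult_left_mono int1 int2) auto
    also have "\<dots> = ennreal (8 * B / (1 + N)) * I"
    proof -
      have "ennreal (B/2) * (ennreal (8 / (1 + N)) * I) = ennreal (4 * B / (1 + N)) * I"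
        using B N by (simp add: mult.assoc[symmetric] flip: ennreal_mult')
      thus ?thesis
        using B N by (simp add: distrib_right[symmetric] flip: ennreal_plus)
    qed
    finally have YI: "ennreal Y \<le> ennreal (8 * B / (1 + N)) * I" .
    have "(\<integral>\<^sup>+ t. ennreal ((cmod (?T t))\<^sup>2) \<partial>?M) =
        (\<integral>\<^sup>+ t. ennreal ((cmod (?T t))\<^sup>2) * indicator {0..1} t \<partial>lebesgue)"
      by (simp add: nn_integral_restrict_space)
    \<comment> \<open>Return from the cutoff to [0,1]: there 1 is at most twice the cutoff, and
      enlarging the domain only adds nonnegative contributions.\<close>
    also have "\<dots> \<le> (\<integral>\<^sup>+ t. (2 * ennreal (cutoff t * (cmod (?T t))\<^sup>2)) * indicator {-1/2..3/2} t \<partial>lebesgue)"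
    proof (rule nn_integral_mono)
      fix t :: real
      show "ennreal ((cmod (?T t))\<^sup>2) * indicator {0..1} t \<le>
        (2 * ennreal (cutoff t * (cmod (?T t))\<^sup>2)) * indicator {-1/2..3/2} t"
      proof (cases "t \<in> {0..1}")
        case True
        have "1 * (cmod (?T t))\<^sup>2 \<le> 2 * cutoff t * (cmod (?T t))\<^sup>2"
          using True cutoff_lower[of t] by (intro mult_right_mono) auto
        hence "ennreal ((cmod (?T t))\<^sup>2) \<le> ennreal (2 * (cutoff t * (cmod (?T t))\<^sup>2))"
          by (intro ennreal_leI) (simp add: mult.assoc)
        also have "\<dots> = 2 * ennreal (cutoff t * (cmod (?T t))\<^sup>2)"
          by (simp add: ennreal_mult')
        finally show ?thesis using True by (simp add: indicator_def)
      qed simp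
    qed
    also have "\<dots> = (\<integral>\<^sup>+ t. 2 * ennreal (cutoff t * (cmod (?T t))\<^sup>2) \<partial>?W)"
      by (simp add: nn_integral_restrict_space)
    also have "\<dots> = 2 * (\<integral>\<^sup>+ t. ennreal (cutoff t * (cmod (?T t))\<^sup>2) \<partial>?W)"
      by (intro nn_integral_cmult) measurable
    also have "(\<integral>\<^sup>+ t. ennreal (cutoff t * (cmod (?T t))\<^sup>2) \<partial>?W) = ennreal Y"
      unfolding Y_def by (rule nn_integral_eq_integral[OF Yint]) (simp add: cutoff_def)
    also have "2 * ennreal Y \<le> 2 * (ennreal (8 * B / (1 + N)) * I)"
      by (intro mult_left_mono YI) simp
    also have "\<dots> = ennreal (16 * B / (1 + N)) * I"
    proof -
      have "ennreal (16 * B / (1 + N)) = ennreal 2 * ennreal (8 * B / (1 + N))"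
        by (subst ennreal_mult'[symmetric]) simp_all
      thus ?thesis by (simp add: mult.assoc)
    qed
    finally show "(\<integral>\<^sup>+ t. ennreal ((cmod (?T t))\<^sup>2) \<partial>?M) \<le> ennreal (16 * B / (1 + N)) * (\<integral>\<^sup>+ s. ennreal ((cmod (f s))\<^sup>2) \<partial>?M)"
      by (simp add: I_def)
  qed
qed

section \<open>Interpolation\<close>

text \<open>A non-integrable function has integral 0 by convention, so the bound persists in that
  case.\<close>

lemma norm_integral_leI:
  fixes w :: "'a \<Rightarrow> complex"
  assumes "(\<integral>\<^sup>+ t. ennreal (cmod (w t)) \<partial>M) \<le> ennreal c" "c \<ge> 0"
  shows "cmod (integral\<^sup>L M w) \<le> c"
proof (cases "integrable M w")
  case True
  hence "ennreal (cmod (integral\<^sup>L M w)) \<le> ennreal c"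
    using integral_norm_bound_ennreal[OF True] assms by (meson order_trans)
  thus ?thesis using assms by simp
qed (use assms in \<open>simp add: not_integrable_integral_eq\<close>)

text \<open>The L^1 to L^\<infinity> bound |T u| \<le> U in bilinear form, as the left edge of the
  strip requires it.\<close>

lemma pairing_bound_L1:
  assumes "\<gamma> \<ge> 0" and u: "integrable unit_lebesgue u" and [measurable]: "v \<in> borel_measurable unit_lebesgue"
    and U: "(\<integral>\<^sup>+ s. ennreal (cmod (u s)) \<partial>unit_lebesgue) \<le> ennreal U" "U \<ge> 0"
    and V: "(\<integral>\<^sup>+ s. ennreal (cmod (v s)) \<partial>unit_lebesgue) \<le> ennreal V" "V \<ge> 0"
  shows "cmod (LINT t|unit_lebesgue. T_op \<gamma> N u t * v t) \<le> U * V"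
proof (rule norm_integral_leI)
  have "ennreal (LINT s|unit_lebesgue. cmod (u s)) \<le> ennreal U"
    using U(1) u by (subst nn_integral_eq_integral[symmetric]) auto
  hence IU: "(LINT s|unit_lebesgue. cmod (u s)) \<le> U" using U(2) by simp
  have T: "cmod (T_op \<gamma> N u t) \<le> U" if "t \<in> space unit_lebesgue" for t
    using norm_T_op_le[OF u \<open>\<gamma> \<ge> 0\<close>, of t N] IU that by simp
  have "(\<integral>\<^sup>+ t. ennreal (cmod (T_op \<gamma> N u t * v t)) \<partial>unit_lebesgue) \<le>
      (\<integral>\<^sup>+ t. ennreal U * ennreal (cmod (v t)) \<partial>unit_lebesgue)"
    using T U by (intro nn_integral_mono) (auto simp: norm_mult ennreal_mult' intro!: mult_right_mono ennreal_leI)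
  also have "\<dots> = ennreal U * (\<integral>\<^sup>+ t. ennreal (cmod (v t)) \<partial>unit_lebesgue)"
    by (intro nn_integral_cmult) measurable
  also have "\<dots> \<le> ennreal U * ennreal V" by (intro mult_left_mono V) simp
  finally show "(\<integral>\<^sup>+ t. ennreal (cmod (T_op \<gamma> N u t * v t)) \<partial>unit_lebesgue) \<le> ennreal (U * V)"
    using U by (simp add: ennreal_mult')
qed (use U V in simp)

text \<open>From (b x - a y)^2 \<ge> 0 one gets x y \<le> b/(2 a) x^2 + a/(2 b) y^2. With these
  weights each term contributes at most a b/2 after integration.\<close>

lemma nn_integral_Cauchy_Schwarz_bound:
  fixes x y :: "'a \<Rightarrow> real"
  assumes [measurable]: "x \<in> borel_measurable M" "y \<in> borel_measurable M"
    and X: "(\<integral>\<^sup>+ t. ennreal ((x t)\<^sup>2) \<partial>M) \<le> ennreal (a\<^sup>2)" "a > 0"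
    and Y: "(\<integral>\<^sup>+ t. ennreal ((y t)\<^sup>2) \<partial>M) \<le> ennreal (b\<^sup>2)" "b > 0"
  shows "(\<integral>\<^sup>+ t. ennreal (x t * y t) \<partial>M) \<le> ennreal (a * b)"
proof -
  have pt: "x t * y t \<le> b / (2 * a) * (x t)\<^sup>2 + a / (2 * b) * (y t)\<^sup>2" for t
  proof -
    have "0 \<le> (b * x t - a * y t)\<^sup>2" by simp
    hence "2 * (a * b) * (x t * y t) \<le> b\<^sup>2 * (x t)\<^sup>2 + a\<^sup>2 * (y t)\<^sup>2"
      by (simp add: power2_eq_square algebra_simps)
    thus ?thesis using X Y by (simp add: field_simps power2_eq_square)
  qed
  have "(\<integral>\<^sup>+ t. ennreal (x t * y t) \<partial>M) \<le>
     (\<integral>\<^sup>+ t. ennreal (b / (2 * a)) * ennreal ((x t)\<^sup>2) + ennreal (a / (2 * b)) * ennreal ((y t)\<^sup>2) \<partial>M)"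
    using X Y pt by (intro nn_integral_mono) (simp flip: ennreal_mult' ennreal_plus)
  also have "\<dots> = ennreal (b / (2 * a)) * (\<integral>\<^sup>+ t. ennreal ((x t)\<^sup>2) \<partial>M)
      + ennreal (a / (2 * b)) * (\<integral>\<^sup>+ t. ennreal ((y t)\<^sup>2) \<partial>M)"
    by (simp add: nn_integral_add nn_integral_cmult)
  also have "\<dots> \<le> ennreal (b / (2 * a)) * ennreal (a\<^sup>2) + ennreal (a / (2 * b)) * ennreal (b\<^sup>2)"
    by (intro add_mono mult_left_mono X Y) auto
  also have "\<dots> = ennreal (b / (2 * a) * a\<^sup>2 + a / (2 * b) * b\<^sup>2)"
    using X Y by (simp flip: ennreal_mult' ennreal_plus)
  also have "b / (2 * a) * a\<^sup>2 + a / (2 * b) * b\<^sup>2 = a * b"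
    using X Y by (simp add: power2_eq_square)
  finally show ?thesis .
qed

lemma T_op_sum:
  assumes "\<gamma> \<ge> 0" "t \<ge> 0" "\<And>a. a \<in> R \<Longrightarrow> integrable unit_lebesgue (u a)"
  shows "T_op \<gamma> N (\<lambda>s. \<Sum>a\<in>R. c a * u a s) t = (\<Sum>a\<in>R. c a * T_op \<gamma> N (u a) t)"
proof -
  have "T_op \<gamma> N (\<lambda>s. \<Sum>a\<in>R. c a * u a s) t =
      (LINT s|unit_lebesgue. (\<Sum>a\<in>R. c a * (kern \<gamma> N t s * u a s)))"
    by (simp add: T_op_kern sum_distrib_left ac_simps)
  also have "\<dots> = (\<Sum>a\<in>R. LINT s|unit_lebesgue. c a * (kern \<gamma> N t s * u a s))"
    using integrable_kern_mult[OF assms(3) assms(1,2)]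
    by (intro Bochner_Integration.integral_sum) auto
  finally show ?thesis by (simp add: T_op_kern)
qed

lemma T_op_cong:
  assumes "\<And>s. s \<in> {0..1} \<Longrightarrow> u s = v s"
  shows "T_op \<gamma> N u t = T_op \<gamma> N v t"
  unfolding T_op_kern by (rule Bochner_Integration.integral_cong) (use assms in auto)

text \<open>The analytic family of the Riesz--Thorin argument: \<open>|a|\<close> is raised to the complex power
  \<open>r (1 - z / 2)\<close>, which is \<open>1\<close> at \<open>z = 2 - 2 / r\<close>.\<close>

definition twist :: "real \<Rightarrow> complex \<Rightarrow> complex \<Rightarrow> complex" where
  "twist r z a = sgn a * exp (of_real (r * ln (cmod a)) * (1 - z / 2))"

text \<open>The modulus is |a|^r on Re z = 0 and |a|^(r/2) on Re z = 1: a function in L^r is turned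
  into one in L^1 on the left edge and into one in L^2 on the right edge.\<close>

lemma norm_twist: "cmod (twist r z a) = cmod a powr (r * (1 - Re z / 2))"
  by (cases "a = 0") (simp_all add: twist_def norm_mult norm_sgn powr_def algebra_simps)

lemma twist_id:
  assumes "r > 0" "z = of_real (2 - 2 / r)"
  shows "twist r z a = a"
proof (cases "a = 0")
  case False
  have e: "of_real (r * ln (cmod a)) * (1 - z / 2) = complex_of_real (ln (cmod a))"
  proof -
    have "of_real r * (1 - z / 2) = 1" using assms by (simp add: field_simps)
    hence "complex_of_real (ln (cmod a)) * (of_real r * (1 - z / 2)) = complex_of_real (ln (cmod a))" by simp
    thus ?thesis by (simp add: ac_simps)
  qed
  hence "twist r z a = sgn a * of_real (cmod a)"
    unfolding twist_def e using False by (simp add: exp_of_real)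
  thus ?thesis by (simp add: sgn_eq False)
qed (simp add: twist_def)

lemma simple_function_bounded:
  assumes "simple_function M (f :: 'a \<Rightarrow> complex)"
  obtains K where "\<And>s. s \<in> space M \<Longrightarrow> cmod (f s) \<le> K"
proof -
  have "bounded (f ` space M)"
    using assms by (intro finite_imp_bounded) (simp add: simple_function_def)
  then obtain K where "\<forall>x\<in>f ` space M. cmod x \<le> K" unfolding bounded_iff by blast
  thus ?thesis using that by blast
qed

lemma simple_function_integrable:
  assumes "simple_function unit_lebesgue (f :: real \<Rightarrow> complex)"
  shows "integrable unit_lebesgue f"
proof -
  obtain K where "\<And>s. s \<in> space unit_lebesgue \<Longrightarrow> cmod (f s) \<le> K"
    using simple_function_bounded[OF assms] by metis
  thus ?thesis using borel_measurable_simple_function[OF assms]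
    by (intro unit.integrable_const_bound[where B = K]) (auto intro!: AE_I2)
qed

text \<open>Twisting both \<open>f\<close> and \<open>g\<close> extends the pairing to a function of
  z. It is bounded by F G on Re z = 0, by the L^1 bound, and by a sqrt (F G) on Re z = 1, by the L^2
  bound and Cauchy-Schwarz. At \<theta> = 2 - 2/r, where both twists are trivial, the three lines
  theorem gives a^\<theta> (F G)^(1 - \<theta>/2), and 1 - \<theta>/2 = 1/r.\<close>

lemma riesz_thorin_simple:
  assumes \<gamma>: "\<gamma> \<ge> 0" and a: "a > 0"
    and L2: "\<And>f K. f \<in> borel_measurable unit_lebesgue \<Longrightarrow> (\<And>s. s \<in> {0..1} \<Longrightarrow> cmod (f s) \<le> K) \<Longrightarrow>
      (\<integral>\<^sup>+ t. ennreal ((cmod (T_op \<gamma> N f t))\<^sup>2) \<partial>unit_lebesgue)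
        \<le> ennreal (a\<^sup>2) * (\<integral>\<^sup>+ s. ennreal ((cmod (f s))\<^sup>2) \<partial>unit_lebesgue)"
    and r: "1 \<le> r" "r \<le> 2"
    and f: "simple_function unit_lebesgue f" and g: "simple_function unit_lebesgue g"
    and F: "(\<integral>\<^sup>+ s. ennreal (cmod (f s) powr r) \<partial>unit_lebesgue) \<le> ennreal F" "F > 0"
    and G: "(\<integral>\<^sup>+ s. ennreal (cmod (g s) powr r) \<partial>unit_lebesgue) \<le> ennreal G" "G > 0"
  shows "cmod (LINT t|unit_lebesgue. T_op \<gamma> N f t * g t) \<le> a powr (2 - 2 / r) * (F * G) powr (1 / r)"
proof -
  let ?M = unit_lebesgue
  define \<Phi> where "\<Phi> z = (LINT t|?M. T_op \<gamma> N (\<lambda>s. twist r z (f s)) t * twist r z (g t))" for z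
  have simp_tw: "simple_function ?M (\<lambda>s. twist r z (u s))" if "simple_function ?M u" for z u
    using simple_function_compose1[OF that] .
  \<comment> \<open>The three lines theorem asks for some bound on the whole strip, whose size
    leaves no trace in the result. Since the exponents occurring there lie in [0, r], the crude
    majorant 1 + y^r serves.\<close>
  have pow_le: "y powr e \<le> 1 + y powr r" if "0 \<le> e" "e \<le> r" "y \<ge> 0" for y e :: real
  proof (cases "y \<le> 1")
    case True
    have "y powr e \<le> 1" using True that by (intro powr_le1) auto
    thus ?thesis using powr_ge_zero[of y r] by linarith
  next
    case False
    have "y powr e \<le> y powr r" using False that by (intro powr_mono) auto
    thus ?thesis by linarith
  qed
  have L1: "(\<integral>\<^sup>+ s. ennreal (cmod (twist r z (u s))) \<partial>?M) \<le> ennreal (1 + U)"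
    if "(\<integral>\<^sup>+ s. ennreal (cmod (u s) powr r) \<partial>?M) \<le> ennreal U" "U > 0" "0 \<le> Re z" "Re z \<le> 1"
      and [measurable]: "u \<in> borel_measurable ?M" for z u U
  proof -
    have "r * Re z \<le> r * 1" using that r by (intro mult_left_mono) auto
    hence "0 \<le> r * (1 - Re z / 2)" "r * (1 - Re z / 2) \<le> r" using that r by (auto simp: algebra_simps)
    hence "(\<integral>\<^sup>+ s. ennreal (cmod (twist r z (u s))) \<partial>?M) \<le> (\<integral>\<^sup>+ s. 1 + ennreal (cmod (u s) powr r) \<partial>?M)"
      unfolding norm_twist
      by (intro nn_integral_mono) (simp add: pow_le flip: ennreal_1 ennreal_plus)
    also have "\<dots> = 1 + (\<integral>\<^sup>+ s. ennreal (cmod (u s) powr r) \<partial>?M)"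
      by (subst nn_integral_add) (auto simp: emeasure_restrict_space)
    also have "\<dots> \<le> 1 + ennreal U" using that by (intro add_left_mono) auto
    finally show ?thesis using that by simp
  qed
  note fm = borel_measurable_simple_function[OF f] and gm = borel_measurable_simple_function[OF g]
  have "cmod (\<Phi> z) \<le> (F * G) powr (1 - Re z) * (a * sqrt (F * G)) powr Re z"
    if "0 \<le> Re z" "Re z \<le> 1" for z
  proof (rule three_lines[OF _ _ _ _ _ _ that])
    fix z assume z: "0 \<le> Re z" "Re z \<le> 1"
    show "cmod (\<Phi> z) \<le> (1 + F) * (1 + G)"
      unfolding \<Phi>_def using F G
      by (intro pairing_bound_L1 \<gamma> simple_function_integrable borel_measurable_simple_function
          simp_tw f g L1 z fm gm) auto
  next
    fix z assume z: "Re z = 0"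
    show "cmod (\<Phi> z) \<le> F * G"
      unfolding \<Phi>_def using F G
      by (intro pairing_bound_L1 \<gamma> simple_function_integrable borel_measurable_simple_function
          simp_tw f g) (simp_all add: norm_twist z)
  next
    fix z assume z: "Re z = 1"
    have sq: "(cmod (twist r z b))\<^sup>2 = cmod b powr r" for b
      by (simp add: norm_twist z power2_eq_square flip: powr_add)
    obtain K where K: "\<And>s. s \<in> space ?M \<Longrightarrow> cmod (twist r z (f s)) \<le> K"
      using simple_function_bounded[OF simp_tw[OF f]] by metis
    have tm: "(\<lambda>s. twist r z (f s)) \<in> borel_measurable ?M" "(\<lambda>s. twist r z (g s)) \<in> borel_measurable ?M"
      using borel_measurable_simple_function[OF simp_tw] f g by auto
    have "(\<integral>\<^sup>+ t. ennreal ((cmod (T_op \<gamma> N (\<lambda>s. twist r z (f s)) t))\<^sup>2) \<partial>?M) \<le>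
        ennreal (a\<^sup>2) * (\<integral>\<^sup>+ s. ennreal ((cmod (twist r z (f s)))\<^sup>2) \<partial>?M)"
      using K by (intro L2[OF tm(1), of K]) auto
    also have "\<dots> \<le> ennreal (a\<^sup>2) * ennreal F"
      unfolding sq by (intro mult_left_mono F) simp
    also have "\<dots> = ennreal ((a * sqrt F)\<^sup>2)"
      using F by (simp add: power_mult_distrib ennreal_mult')
    finally have X: "(\<integral>\<^sup>+ t. ennreal ((cmod (T_op \<gamma> N (\<lambda>s. twist r z (f s)) t))\<^sup>2) \<partial>?M) \<le> ennreal ((a * sqrt F)\<^sup>2)" .
    have Y: "(\<integral>\<^sup>+ t. ennreal ((cmod (twist r z (g t)))\<^sup>2) \<partial>?M) \<le> ennreal ((sqrt G)\<^sup>2)"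
      unfolding sq using G by simp
    have [measurable]: "T_op \<gamma> N (\<lambda>s. twist r z (f s)) \<in> borel_measurable ?M"
      by (rule T_op_measurable[OF tm(1)])
    note tm(2)[measurable]
    have "(\<integral>\<^sup>+ t. ennreal (cmod (T_op \<gamma> N (\<lambda>s. twist r z (f s)) t) * cmod (twist r z (g t))) \<partial>?M) \<le> ennreal ((a * sqrt F) * sqrt G)"
      using a F G by (intro nn_integral_Cauchy_Schwarz_bound X Y) auto
    hence "cmod (\<Phi> z) \<le> (a * sqrt F) * sqrt G"
      unfolding \<Phi>_def using a F G by (intro norm_integral_leI) (simp_all add: norm_mult)
    thus "cmod (\<Phi> z) \<le> a * sqrt (F * G)" by (simp add: real_sqrt_mult)
  next
    \<comment> \<open>Simplicity of \<open>f\<close> and \<open>g\<close> pays off here: \<Phi> is a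
      finite combination of products of exponentials in z, with coefficients free of z, hence
      entire.\<close>
    define Rf where "Rf = f ` space ?M"
    define Rg where "Rg = g ` space ?M"
    define uf where "uf b = (indicator (f -` {b} \<inter> space ?M) :: real \<Rightarrow> complex)" for b
    define ug where "ug b = (indicator (g -` {b} \<inter> space ?M) :: real \<Rightarrow> complex)" for b
    have fin: "finite Rf" "finite Rg" using f g by (auto simp: Rf_def Rg_def simple_function_def)
    have um: "uf b \<in> borel_measurable ?M" "ug b \<in> borel_measurable ?M" for b
      unfolding uf_def ug_def using simple_functionD(2)[OF f] simple_functionD(2)[OF g]
      by (auto intro!: borel_measurable_indicator)
    have ui: "integrable ?M (uf b)" "integrable ?M (ug b)" for b
      using um by (auto intro!: unit.integrable_const_bound[where B = 1] AE_I2 simp: uf_def ug_def indicator_def)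
    have ef: "twist r z (f s) = (\<Sum>b\<in>Rf. twist r z b * uf b s)" if "s \<in> space ?M" for s z
    proof -
      have "(\<Sum>b\<in>Rf. twist r z b * uf b s) = (\<Sum>b\<in>Rf. if b = f s then twist r z b else 0)"
        using that by (intro sum.cong) (auto simp: uf_def indicator_def)
      thus ?thesis using fin that by (simp add: Rf_def)
    qed
    have eg: "twist r z (g s) = (\<Sum>b\<in>Rg. twist r z b * ug b s)" if "s \<in> space ?M" for s z
    proof -
      have "(\<Sum>b\<in>Rg. twist r z b * ug b s) = (\<Sum>b\<in>Rg. if b = g s then twist r z b else 0)"
        using that by (intro sum.cong) (auto simp: ug_def indicator_def)
      thus ?thesis using fin that by (simp add: Rg_def)
    qed
    have int: "integrable ?M (\<lambda>t. T_op \<gamma> N (uf b) t * ug d t)" for b d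
    proof (rule unit.integrable_const_bound[where B = "LINT s|?M. cmod (uf b s)"])
      show "AE t in ?M. cmod (T_op \<gamma> N (uf b) t * ug d t) \<le> (LINT s|?M. cmod (uf b s))"
        using norm_T_op_le[OF ui(1) \<gamma>, of _ N b]
        by (intro AE_I2) (auto simp: ug_def indicator_def)
      show "(\<lambda>t. T_op \<gamma> N (uf b) t * ug d t) \<in> borel_measurable ?M"
        using T_op_measurable[OF um(1)] um(2) by (intro borel_measurable_times) auto
    qed
    have "\<Phi> z = (\<Sum>b\<in>Rf. \<Sum>d\<in>Rg. twist r z b * twist r z d * (LINT t|?M. T_op \<gamma> N (uf b) t * ug d t))" for z
    proof -
      have "\<Phi> z = (LINT t|?M. (\<Sum>b\<in>Rf. \<Sum>d\<in>Rg. (twist r z b * twist r z d) * (T_op \<gamma> N (uf b) t * ug d t)))"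
        unfolding \<Phi>_def
      proof (rule Bochner_Integration.integral_cong)
        fix t assume t: "t \<in> space ?M"
        have "T_op \<gamma> N (\<lambda>s. twist r z (f s)) t = T_op \<gamma> N (\<lambda>s. \<Sum>b\<in>Rf. twist r z b * uf b s) t"
          by (rule T_op_cong) (use ef in auto)
        also have "\<dots> = (\<Sum>b\<in>Rf. twist r z b * T_op \<gamma> N (uf b) t)"
          using t by (intro T_op_sum \<gamma> ui) auto
        finally have T: "T_op \<gamma> N (\<lambda>s. twist r z (f s)) t = (\<Sum>b\<in>Rf. twist r z b * T_op \<gamma> N (uf b) t)" .
        show "T_op \<gamma> N (\<lambda>s. twist r z (f s)) t * twist r z (g t) =
            (\<Sum>b\<in>Rf. \<Sum>d\<in>Rg. (twist r z b * twist r z d) * (T_op \<gamma> N (uf b) t * ug d t))"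
          unfolding T eg[OF t] sum_product by (simp only: ac_simps)
      qed simp
      also have "\<dots> = (\<Sum>b\<in>Rf. \<Sum>d\<in>Rg. twist r z b * twist r z d * (LINT t|?M. T_op \<gamma> N (uf b) t * ug d t))"
        using int by (subst Bochner_Integration.integral_sum; simp)+
      finally show ?thesis .
    qed
    hence "\<Phi> = (\<lambda>z. \<Sum>b\<in>Rf. \<Sum>d\<in>Rg. twist r z b * twist r z d * (LINT t|?M. T_op \<gamma> N (uf b) t * ug d t))"
      by auto
    thus "\<Phi> holomorphic_on UNIV"
      unfolding twist_def by (auto intro!: holomorphic_intros)
  qed (use a F G in auto)
  moreover define \<theta> where "\<theta> = 2 - 2 / r"
  have \<theta>: "0 \<le> \<theta>" "\<theta> \<le> 1" using r by (auto simp: \<theta>_def field_simps)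
  ultimately have "cmod (\<Phi> (of_real \<theta>)) \<le> (F * G) powr (1 - \<theta>) * (a * sqrt (F * G)) powr \<theta>"
    by (metis Re_complex_of_real)
  also have "(a * sqrt (F * G)) powr \<theta> = a powr \<theta> * (F * G) powr (\<theta> / 2)"
    using a F G by (simp add: powr_mult powr_powr flip: powr_half_sqrt)
  also have "(F * G) powr (1 - \<theta>) * (a powr \<theta> * (F * G) powr (\<theta> / 2)) = a powr \<theta> * (F * G) powr (1 - \<theta> + \<theta> / 2)"
    by (simp only: powr_add ac_simps)
  also have "1 - \<theta> + \<theta> / 2 = 1 / r" using r by (simp add: \<theta>_def field_simps)
  also have "\<Phi> (of_real \<theta>) = (LINT t|?M. T_op \<gamma> N f t * g t)"
    using r by (simp add: \<Phi>_def twist_id \<theta>_def)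
  finally show ?thesis by (simp add: \<theta>_def)
qed

section \<open>From simple functions to L^p, and from pairings to norms\<close>

lemma Lp_norm_1: "Lp_norm M 1 f = (\<integral>\<^sup>+ x. ennreal (norm (f x)) \<partial>M)"
  using Lp_norm_ennreal[of 1 M f] by (simp add: Let_def less_top)

lemma Lp_funs_integrable:
  assumes "f \<in> Lp_funs unit_lebesgue p" "1 \<le> p"
  shows "integrable unit_lebesgue f"
proof (rule integrableI_bounded)
  show fm: "f \<in> borel_measurable unit_lebesgue" using assms by (simp add: Lp_funs_def)
  have "Lp_norm unit_lebesgue 1 f \<le> Lp_norm unit_lebesgue p f"
    by (rule unit.Lp_norm_mono[OF fm]) (use assms in auto)
  also have "\<dots> < \<infinity>" using assms by (simp add: Lp_funs_def)
  finally show "(\<integral>\<^sup>+ x. ennreal (cmod (f x)) \<partial>unit_lebesgue) < \<infinity>"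
    by (simp add: Lp_norm_1)
qed

lemma Lp_norm_infinity_T_op_le:
  assumes f: "integrable unit_lebesgue f" and "\<gamma> \<ge> 0"
  shows "Lp_norm unit_lebesgue \<infinity> (T_op \<gamma> N f) \<le> Lp_norm unit_lebesgue 1 f"
proof -
  have "Lp_norm unit_lebesgue \<infinity> (T_op \<gamma> N f) \<le> ennreal (LINT s|unit_lebesgue. cmod (f s))"
    using norm_T_op_le[OF f \<open>\<gamma> \<ge> 0\<close>] f
    by (intro Lp_norm_infinity_leI T_op_measurable AE_I2) auto
  also have "\<dots> = (\<integral>\<^sup>+ s. ennreal (cmod (f s)) \<partial>unit_lebesgue)"
    using f by (intro nn_integral_eq_integral[symmetric]) auto
  finally show ?thesis by (simp add: Lp_norm_1)
qed

lemma nn_integral_powr_double: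
  assumes [measurable]: "f \<in> borel_measurable M"
    and le: "\<And>x. x \<in> space M \<Longrightarrow> cmod (g x) \<le> 2 * cmod (f x)"
    and F: "(\<integral>\<^sup>+ x. ennreal (cmod (f x) powr r) \<partial>M) \<le> ennreal F" and "r > 0"
  shows "(\<integral>\<^sup>+ x. ennreal (cmod (g x) powr r) \<partial>M) \<le> ennreal (2 powr r * F)"
proof -
  have "(\<integral>\<^sup>+ x. ennreal (cmod (g x) powr r) \<partial>M) \<le> (\<integral>\<^sup>+ x. ennreal (2 powr r) * ennreal (cmod (f x) powr r) \<partial>M)"
  proof (rule nn_integral_mono)
    fix x assume "x \<in> space M"
    hence "cmod (g x) powr r \<le> (2 * cmod (f x)) powr r"
      using le \<open>r > 0\<close> by (intro powr_mono2) auto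
    thus "ennreal (cmod (g x) powr r) \<le> ennreal (2 powr r) * ennreal (cmod (f x) powr r)"
      by (simp add: powr_mult flip: ennreal_mult')
  qed
  also have "\<dots> = ennreal (2 powr r) * (\<integral>\<^sup>+ x. ennreal (cmod (f x) powr r) \<partial>M)"
    by (intro nn_integral_cmult) measurable
  also have "\<dots> \<le> ennreal (2 powr r) * ennreal F" by (intro mult_left_mono F) simp
  finally show ?thesis by (simp add: ennreal_mult')
qed

lemma T_op_tendsto:
  assumes f: "integrable unit_lebesgue f" and "\<gamma> \<ge> 0" "t \<ge> 0"
    and fm: "\<And>n. fn n \<in> borel_measurable unit_lebesgue"
    and lim: "\<And>s. s \<in> space unit_lebesgue \<Longrightarrow> (\<lambda>n. fn n s) \<longlonglongrightarrow> f s"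
    and le: "\<And>n s. s \<in> space unit_lebesgue \<Longrightarrow> cmod (fn n s) \<le> 2 * cmod (f s)"
  shows "(\<lambda>n. T_op \<gamma> N (fn n) t) \<longlonglongrightarrow> T_op \<gamma> N f t"
  unfolding T_op_kern
proof (rule integral_dominated_convergence)
  show "integrable unit_lebesgue (\<lambda>s. 2 * cmod (f s))" using f by simp
  have [measurable]: "f \<in> borel_measurable unit_lebesgue" using f by simp
  note fm[measurable]
  show "(\<lambda>s. kern \<gamma> N t s * f s) \<in> borel_measurable unit_lebesgue" by measurable
  show "(\<lambda>s. kern \<gamma> N t s * fn n s) \<in> borel_measurable unit_lebesgue" for n by measurable
  show "AE s in unit_lebesgue. (\<lambda>n. kern \<gamma> N t s * fn n s) \<longlonglongrightarrow> kern \<gamma> N t s * f s"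
    using lim by (intro AE_I2 tendsto_intros) auto
  show "AE s in unit_lebesgue. norm (kern \<gamma> N t s * fn n s) \<le> 2 * cmod (f s)" for n
  proof (rule AE_I2)
    fix s assume s: "s \<in> space unit_lebesgue"
    have "norm (kern \<gamma> N t s * fn n s) \<le> 1 * (2 * cmod (f s))"
      unfolding norm_mult using s assms(2,3) le by (intro mult_mono norm_kern_le_1) auto
    thus "norm (kern \<gamma> N t s * fn n s) \<le> 2 * cmod (f s)" by simp
  qed
qed

text \<open>Both arguments are approximated by simple functions of at most twice their modulus,
  which costs the factor 2 * 2 = 4. Boundedness of \<open>g\<close> and the L^1 bound on the outputs
  supply a constant majorant for dominated convergence in t.\<close>

lemma riesz_thorin_pairing:
  assumes \<gamma>: "\<gamma> \<ge> 0" and a: "a > 0"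
    and L2: "\<And>f K. f \<in> borel_measurable unit_lebesgue \<Longrightarrow> (\<And>s. s \<in> {0..1} \<Longrightarrow> cmod (f s) \<le> K) \<Longrightarrow>
      (\<integral>\<^sup>+ t. ennreal ((cmod (T_op \<gamma> N f t))\<^sup>2) \<partial>unit_lebesgue)
        \<le> ennreal (a\<^sup>2) * (\<integral>\<^sup>+ s. ennreal ((cmod (f s))\<^sup>2) \<partial>unit_lebesgue)"
    and r: "1 \<le> r" "r \<le> 2"
    and f: "integrable unit_lebesgue f"
    and g[measurable]: "g \<in> borel_measurable unit_lebesgue" and gK: "\<And>s. s \<in> {0..1} \<Longrightarrow> cmod (g s) \<le> K"
    and F: "(\<integral>\<^sup>+ s. ennreal (cmod (f s) powr r) \<partial>unit_lebesgue) \<le> ennreal F" "F > 0"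
    and G: "(\<integral>\<^sup>+ s. ennreal (cmod (g s) powr r) \<partial>unit_lebesgue) \<le> ennreal G" "G > 0"
  shows "cmod (LINT t|unit_lebesgue. T_op \<gamma> N f t * g t) \<le> 4 * a powr (2 - 2 / r) * (F * G) powr (1 / r)"
proof -
  let ?M = unit_lebesgue
  have fm[measurable]: "f \<in> borel_measurable ?M" using f by simp
  have approx: "\<exists>un. (\<forall>n. simple_function ?M (un n)) \<and> (\<forall>s\<in>space ?M. (\<lambda>n. un n s) \<longlonglongrightarrow> u s) \<and>
      (\<forall>n. \<forall>s\<in>space ?M. cmod (un n s) \<le> 2 * cmod (u s))"
    if "u \<in> borel_measurable ?M" for u :: "real \<Rightarrow> complex"
    using borel_measurable_implies_sequence_metric[OF that, of 0] by simp
  from approx[OF fm] obtain fn where fn: "\<And>n. simple_function ?M (fn n)"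
      "\<And>s. s \<in> space ?M \<Longrightarrow> (\<lambda>n. fn n s) \<longlonglongrightarrow> f s" "\<And>n s. s \<in> space ?M \<Longrightarrow> cmod (fn n s) \<le> 2 * cmod (f s)"
    by blast
  from approx[OF g] obtain gn where gn: "\<And>n. simple_function ?M (gn n)"
      "\<And>s. s \<in> space ?M \<Longrightarrow> (\<lambda>n. gn n s) \<longlonglongrightarrow> g s" "\<And>n s. s \<in> space ?M \<Longrightarrow> cmod (gn n s) \<le> 2 * cmod (g s)"
    by blast
  have [measurable]: "fn n \<in> borel_measurable ?M" "gn n \<in> borel_measurable ?M" for n
    using fn gn borel_measurable_simple_function by blast+
  have [measurable]: "T_op \<gamma> N f \<in> borel_measurable ?M" "T_op \<gamma> N (fn n) \<in> borel_measurable ?M" for n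
    by (intro T_op_measurable; measurable)+
  define I where "I = (LINT s|?M. cmod (f s))"
  have I0: "I \<ge> 0" unfolding I_def by simp
  have K0: "K \<ge> 0" using order_trans[OF norm_ge_zero gK[of 0]] by simp
  have "(\<lambda>n. LINT t|?M. T_op \<gamma> N (fn n) t * gn n t) \<longlonglongrightarrow> (LINT t|?M. T_op \<gamma> N f t * g t)"
  proof (rule integral_dominated_convergence)
    show "integrable ?M (\<lambda>t. (2 * I) * (2 * K))" by simp
    show "AE t in ?M. (\<lambda>n. T_op \<gamma> N (fn n) t * gn n t) \<longlonglongrightarrow> T_op \<gamma> N f t * g t"
      using fn gn by (intro AE_I2 tendsto_mult T_op_tendsto f \<gamma>) auto
    show "AE t in ?M. norm (T_op \<gamma> N (fn n) t * gn n t) \<le> (2 * I) * (2 * K)" for n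
    proof (rule AE_I2)
      fix t assume t: "t \<in> space ?M"
      have fi: "integrable ?M (fn n)" by (rule simple_function_integrable[OF fn(1)])
      have "cmod (T_op \<gamma> N (fn n) t) \<le> (LINT s|?M. cmod (fn n s))"
        using t by (intro norm_T_op_le fi \<gamma>) auto
      also have "\<dots> \<le> (LINT s|?M. 2 * cmod (f s))"
        using fi f fn(3) by (intro integral_mono) auto
      also have "\<dots> = 2 * I" by (simp add: I_def)
      finally have "cmod (T_op \<gamma> N (fn n) t) \<le> 2 * I" .
      moreover have "cmod (gn n t) \<le> 2 * K" using gn(3)[OF t, of n] gK[of t] t by auto
      ultimately show "norm (T_op \<gamma> N (fn n) t * gn n t) \<le> (2 * I) * (2 * K)"
        unfolding norm_mult using I0 by (intro mult_mono) auto
    qed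
  qed measurable
  hence "(\<lambda>n. cmod (LINT t|?M. T_op \<gamma> N (fn n) t * gn n t)) \<longlonglongrightarrow> cmod (LINT t|?M. T_op \<gamma> N f t * g t)"
    by (rule tendsto_norm)
  moreover have "cmod (LINT t|?M. T_op \<gamma> N (fn n) t * gn n t) \<le> 4 * a powr (2 - 2 / r) * (F * G) powr (1 / r)" for n
  proof -
    have "cmod (LINT t|?M. T_op \<gamma> N (fn n) t * gn n t) \<le>
        a powr (2 - 2 / r) * ((2 powr r * F) * (2 powr r * G)) powr (1 / r)"
    proof (rule riesz_thorin_simple[OF \<gamma> a _ r fn(1) gn(1)])
      show "(\<integral>\<^sup>+ s. ennreal (cmod (fn n s) powr r) \<partial>?M) \<le> ennreal (2 powr r * F)"
        using fn(3) r by (intro nn_integral_powr_double[OF fm _ F(1)]) auto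
      show "(\<integral>\<^sup>+ s. ennreal (cmod (gn n s) powr r) \<partial>?M) \<le> ennreal (2 powr r * G)"
        using gn(3) r by (intro nn_integral_powr_double[OF g _ G(1)]) auto
    qed (fact L2, use F G in auto)
    also have "((2 powr r * F) * (2 powr r * G)) powr (1 / r) = 4 * (F * G) powr (1 / r)"
      using r F(2) G(2) by (simp add: powr_mult powr_powr)
    finally show ?thesis by (simp add: ac_simps)
  qed
  ultimately show ?thesis by (intro LIMSEQ_le_const2) auto
qed

text \<open>Duality with the extremal test function: for h = T f and g = cnj (sgn h) |h|^(q - 1) one
  has h g = |h|^q and |g|^r = |h|^q, because (q - 1) r = q. If J is the integral of |h|^q, the
  pairing bound reads J \<le> c J^(1/r), that is, J^(1/q) \<le> c.\<close>

lemma riesz_thorin_dual: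
  assumes \<gamma>: "\<gamma> \<ge> 0" and a: "a > 0"
    and L2: "\<And>f K. f \<in> borel_measurable unit_lebesgue \<Longrightarrow> (\<And>s. s \<in> {0..1} \<Longrightarrow> cmod (f s) \<le> K) \<Longrightarrow>
      (\<integral>\<^sup>+ t. ennreal ((cmod (T_op \<gamma> N f t))\<^sup>2) \<partial>unit_lebesgue)
        \<le> ennreal (a\<^sup>2) * (\<integral>\<^sup>+ s. ennreal ((cmod (f s))\<^sup>2) \<partial>unit_lebesgue)"
    and r: "1 < r" "r \<le> 2" and q: "1 / q = 1 - 1 / r"
    and f: "integrable unit_lebesgue f"
    and F: "(\<integral>\<^sup>+ s. ennreal (cmod (f s) powr r) \<partial>unit_lebesgue) \<le> ennreal F" "F > 0"
  shows "Lp_norm unit_lebesgue (ennreal q) (T_op \<gamma> N f) \<le> ennreal (4 * a powr (2 - 2 / r) * F powr (1 / r))"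
proof -
  let ?M = unit_lebesgue
  define h where "h = T_op \<gamma> N f"
  define c where "c = 4 * a powr (2 - 2 / r) * F powr (1 / r)"
  have c: "c > 0" using a F by (simp add: c_def)
  have "1 / q > 0" using r q by simp
  hence q0: "q > 0" by simp
  have qr: "(q - 1) * r = q" using q q0 r by (simp add: field_simps)
  have q1: "q > 1"
  proof -
    have "1 / q < 1" using r q by simp
    thus ?thesis using q0 by (simp add: field_simps)
  qed
  have hm[measurable]: "h \<in> borel_measurable ?M" unfolding h_def using f by (intro T_op_measurable) simp
  define I where "I = (LINT s|?M. cmod (f s))"
  have I0: "I \<ge> 0" unfolding I_def by simp
  have hI: "cmod (h t) \<le> I" if "t \<in> {0..1}" for t
    unfolding h_def I_def using that by (intro norm_T_op_le f \<gamma>) auto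
  define g where "g t = cnj (sgn (h t)) * of_real (cmod (h t) powr (q - 1))" for t
  have ng: "cmod (g t) = cmod (h t) powr (q - 1)" for t
    by (cases "h t = 0") (simp_all add: g_def norm_mult norm_sgn)
  have hg: "h t * g t = of_real (cmod (h t) powr q)" for t
  proof (cases "h t = 0")
    case False
    have "h t * cnj (sgn (h t)) = of_real (cmod (h t))"
      using False by (simp add: sgn_eq complex_norm_square[symmetric] power2_eq_square)
    hence "h t * g t = of_real (cmod (h t) * cmod (h t) powr (q - 1))"
      by (simp add: g_def mult.assoc[symmetric])
    also have "cmod (h t) * cmod (h t) powr (q - 1) = cmod (h t) powr q"
      using False by (simp add: powr_mult_base)
    finally show ?thesis .
  qed (simp add: g_def)
  have gm[measurable]: "g \<in> borel_measurable ?M"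
    unfolding g_def[abs_def] sgn_eq by measurable
  have hqI: "cmod (h t) powr q \<le> I powr q" if "t \<in> {0..1}" for t
    using hI[OF that] q0 by (intro powr_mono2) auto
  \<comment> \<open>The later division by a power of J is legitimate only for finite J. Finiteness
    holds because h is bounded by the L^1 norm of f.\<close>
  have hq: "integrable ?M (\<lambda>t. cmod (h t) powr q)"
    using hqI by (intro unit.integrable_const_bound[where B = "I powr q"] AE_I2) auto
  define J where "J = (LINT t|?M. cmod (h t) powr q)"
  have J: "(\<integral>\<^sup>+ t. ennreal (cmod (h t) powr q) \<partial>?M) = ennreal J"
    unfolding J_def by (intro nn_integral_eq_integral hq) simp
  have J0: "J \<ge> 0" unfolding J_def by simp
  have "J \<le> c powr q"
  proof (cases "J = 0")
    case False
    hence Jp: "J > 0" using J0 by simp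
    have "J = cmod (LINT t|?M. T_op \<gamma> N f t * g t)"
      using J0 by (simp add: hg[unfolded h_def] J_def h_def)
    also have "\<dots> \<le> 4 * a powr (2 - 2 / r) * (F * J) powr (1 / r)"
    proof (rule riesz_thorin_pairing[OF \<gamma> a L2 _ _ f gm _ F])
      show "cmod (g s) \<le> I powr (q - 1)" if "s \<in> {0..1}" for s
        unfolding ng using hI[OF that] q1 by (intro powr_mono2) auto
      show "(\<integral>\<^sup>+ s. ennreal (cmod (g s) powr r) \<partial>?M) \<le> ennreal J"
        unfolding ng powr_powr qr J by simp
    qed (use r Jp in auto)
    also have "\<dots> = c * J powr (1 / r)" using F Jp by (simp add: c_def powr_mult)
    finally have "J / J powr (1 / r) \<le> c" using Jp by (simp add: field_simps)
    also have "J / J powr (1 / r) = J powr (1 / q)"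
      using Jp by (simp add: q powr_diff)
    finally have "(J powr (1 / q)) powr q \<le> c powr q" using q0 by (intro powr_mono2) auto
    thus ?thesis using Jp q0 by (simp add: powr_powr)
  qed (use c in simp)
  hence "(\<integral>\<^sup>+ t. ennreal (cmod (h t) powr q) \<partial>?M) \<le> ennreal (c powr q)"
    unfolding J by (rule ennreal_leI)
  thus ?thesis unfolding h_def c_def[symmetric] using q0 c by (intro Lp_norm_leI) auto
qed

lemma conjugate_bound:
  assumes \<gamma>: "\<gamma> \<ge> 0"
  obtains C where "C \<ge> 1"
    "\<And>N p q f. N \<ge> 0 \<Longrightarrow> 1 \<le> p \<Longrightarrow> 1 \<le> q \<Longrightarrow> recip q = 1 - recip p \<Longrightarrow> 1/2 \<le> recip p \<Longrightarrow>
       f \<in> Lp_funs unit_lebesgue p \<Longrightarrow> \<not> (AE x in unit_lebesgue. f x = 0) \<Longrightarrow>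
       Lp_norm unit_lebesgue q (T_op \<gamma> N f) \<le> ennreal (C * (1 + N) powr (-1 + recip p)) * Lp_norm unit_lebesgue p f"
proof -
  let ?M = unit_lebesgue
  obtain A0 where A0: "A0 > 0"
    "\<And>N f K. N \<ge> 0 \<Longrightarrow> f \<in> borel_measurable ?M \<Longrightarrow> (\<And>s. s \<in> {0..1} \<Longrightarrow> cmod (f s) \<le> K) \<Longrightarrow>
      (\<integral>\<^sup>+ t. ennreal ((cmod (T_op \<gamma> N f t))\<^sup>2) \<partial>?M)
        \<le> ennreal (A0 / (1 + N)) * (\<integral>\<^sup>+ s. ennreal ((cmod (f s))\<^sup>2) \<partial>?M)"
    using T_op_L2_bound[OF \<gamma>] by metis
  define A where "A = max 1 A0"
  have A: "A \<ge> 1" "A0 \<le> A" by (auto simp: A_def)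
  show ?thesis
  proof (rule that[of "4 * A"])
    show "4 * A \<ge> 1" using A by simp
    fix N :: real and p q :: ennreal and f :: "real \<Rightarrow> complex"
    assume N: "N \<ge> 0" and p: "1 \<le> p" and q: "1 \<le> q" and pq: "recip q = 1 - recip p" and hp: "1/2 \<le> recip p"
      and f: "f \<in> Lp_funs ?M p" and nz: "\<not> (AE x in ?M. f x = 0)"
    have fi: "integrable ?M f" by (rule Lp_funs_integrable[OF f p])
    from p obtain r where r: "p = ennreal r" "r \<ge> 1" "recip p = 1 / r"
      by (cases rule: exponent_cases) (use hp in auto)
    have "1/2 \<le> 1 / r" using hp unfolding r(3) .
    hence r2: "r \<le> 2" using r(2) by (simp add: field_simps)
    show "Lp_norm ?M q (T_op \<gamma> N f) \<le> ennreal (4 * A * (1 + N) powr (-1 + recip p)) * Lp_norm ?M p f"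
    proof (cases "r = 1")
      case True
      have "q = \<infinity>" using q by (cases rule: exponent_cases) (use pq r True in auto)
      hence "Lp_norm ?M q (T_op \<gamma> N f) \<le> 1 * Lp_norm ?M p f"
        using Lp_norm_infinity_T_op_le[OF fi \<gamma>, of N] r True by simp
      also have "\<dots> \<le> ennreal (4 * A * (1 + N) powr (-1 + recip p)) * Lp_norm ?M p f"
        using A r True N by (intro mult_right_mono) (auto simp flip: ennreal_1)
      finally show ?thesis .
    next
      case False
      hence r1: "r > 1" using r by simp
      obtain s where s: "q = ennreal s" "s \<ge> 1" "recip q = 1 / s"
        using q by (cases rule: exponent_cases) (use pq r r1 in auto)
      define a where "a = sqrt (A / (1 + N))"
      have a: "a > 0" using A N by (simp add: a_def)
      have L2: "(\<integral>\<^sup>+ t. ennreal ((cmod (T_op \<gamma> N f t))\<^sup>2) \<partial>?M)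
          \<le> ennreal (a\<^sup>2) * (\<integral>\<^sup>+ s. ennreal ((cmod (f s))\<^sup>2) \<partial>?M)"
        if "f \<in> borel_measurable ?M" "\<And>s. s \<in> {0..1} \<Longrightarrow> cmod (f s) \<le> K" for f K
      proof -
        have "ennreal (A0 / (1 + N)) \<le> ennreal (a\<^sup>2)"
          using A N by (intro ennreal_leI) (simp add: a_def divide_right_mono)
        thus ?thesis using A0(2)[OF N that] by (meson mult_right_mono order_trans zero_le)
      qed
      obtain F where F: "F \<ge> 0" "(\<integral>\<^sup>+ x. ennreal (cmod (f x) powr r) \<partial>?M) = ennreal F"
        "Lp_norm ?M p f = ennreal (F powr (1 / r))"
        using Lp_norm_finite_integral[of r f ?M] f r by auto
      \<comment> \<open>The boundary bounds in the three lines theorem have to be strictly positive;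
        this is where f not vanishing almost everywhere enters.\<close>
      have "0 < Lp_norm ?M p f" using f nz p by (intro Lp_norm_pos) (auto simp: Lp_funs_def)
      hence Fp: "F > 0" using F by (cases "F = 0") auto
      have "Lp_norm ?M q (T_op \<gamma> N f) \<le> ennreal (4 * a powr (2 - 2 / r) * F powr (1 / r))"
        unfolding s(1) using pq r s F Fp by (intro riesz_thorin_dual \<gamma> a L2 r1 r2 fi) auto
      also have "\<dots> = ennreal (4 * a powr (2 - 2 / r)) * Lp_norm ?M p f"
        by (simp add: F ennreal_mult')
      also have "\<dots> \<le> ennreal (4 * A * (1 + N) powr (-1 + recip p)) * Lp_norm ?M p f"
      proof (intro mult_right_mono ennreal_leI)
        have "a powr (2 - 2 / r) = (A / (1 + N)) powr (1 - 1 / r)"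
        proof -
          have e: "1 / 2 * (2 - 2 / r) = 1 - 1 / r" by (simp add: field_simps)
          have "0 \<le> A / (1 + N)" using A N by simp
          thus ?thesis unfolding a_def by (simp only: powr_half_sqrt[symmetric] powr_powr e)
        qed
        also have "\<dots> = A powr (1 - 1 / r) * (1 + N) powr (-1 + recip p)"
        proof -
          have "(1 + N) powr (1 - 1 / r) * (1 + N) powr (-1 + recip p) = 1"
            using N unfolding r(3) by (simp flip: powr_add)
          thus ?thesis using A N by (simp add: powr_divide field_simps)
        qed
        also have "\<dots> \<le> A powr 1 * (1 + N) powr (-1 + recip p)"
          using A r by (intro mult_right_mono powr_mono) auto
        finally show "4 * a powr (2 - 2 / r) \<le> 4 * A * (1 + N) powr (-1 + recip p)"
          using A by simp
      qed simp
      finally show ?thesis .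
    qed
  qed
qed

text \<open>The exponents \<open>p0\<close> and \<open>q0\<close> with reciprocals x and 1 - x are
  conjugate, and p0 \<le> p, q \<le> q0. On a probability space L^p embeds into L^p0, and L^q0 into
  L^q, with norm at most 1, so the conjugate bound is inherited. The free parameter x lets one
  statement serve all regions.\<close>

lemma C_const_upper:
  assumes \<gamma>: "\<gamma> \<ge> 0"
  obtains C where "C \<ge> 1"
    "\<And>N p q x. N \<ge> 0 \<Longrightarrow> 1 \<le> p \<Longrightarrow> 1 \<le> q \<Longrightarrow> 1/2 \<le> x \<Longrightarrow> x \<le> 1 \<Longrightarrow> recip p \<le> x \<Longrightarrow> 1 - x \<le> recip q \<Longrightarrow>
       C_const \<gamma> N p q \<le> ennreal (C * (1 + N) powr (-1 + x))"
proof -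
  obtain C where C: "C \<ge> 1"
    "\<And>N p q f. N \<ge> 0 \<Longrightarrow> 1 \<le> p \<Longrightarrow> 1 \<le> q \<Longrightarrow> recip q = 1 - recip p \<Longrightarrow> 1/2 \<le> recip p \<Longrightarrow>
       f \<in> Lp_funs unit_lebesgue p \<Longrightarrow> \<not> (AE x in unit_lebesgue. f x = 0) \<Longrightarrow>
       Lp_norm unit_lebesgue q (T_op \<gamma> N f) \<le> ennreal (C * (1 + N) powr (-1 + recip p)) * Lp_norm unit_lebesgue p f"
    using conjugate_bound[OF \<gamma>] by metis
  show ?thesis
  proof (rule that[OF C(1)])
    fix N :: real and p q :: ennreal and x :: real
    assume N: "N \<ge> 0" and p: "1 \<le> p" and q: "1 \<le> q" and x: "1/2 \<le> x" "x \<le> 1" "recip p \<le> x" "1 - x \<le> recip q"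
    have "0 \<le> x" using x by simp
    then obtain p0 where p0: "1 \<le> p0" "recip p0 = x" using exponent_with_recip x by metis
    have "0 \<le> 1 - x" "1 - x \<le> 1" using x by auto
    then obtain q0 where q0: "1 \<le> q0" "recip q0 = 1 - x" using exponent_with_recip by metis
    have le: "p0 \<le> p" "q \<le> q0" using p q p0 q0 x by (simp_all add: exponent_le_iff_recip)
    show "C_const \<gamma> N p q \<le> ennreal (C * (1 + N) powr (-1 + x))"
      unfolding C_const_def
    proof (rule SUP_least)
      fix f assume "f \<in> {f \<in> Lp_funs unit_lebesgue p. \<not> (AE x in unit_lebesgue. f x = 0)}"
      hence f: "f \<in> Lp_funs unit_lebesgue p" and nz: "\<not> (AE x in unit_lebesgue. f x = 0)" by auto
      have fm: "f \<in> borel_measurable unit_lebesgue" using f by (simp add: Lp_funs_def)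
      have mono: "Lp_norm unit_lebesgue p0 f \<le> Lp_norm unit_lebesgue p f"
        by (rule unit.Lp_norm_mono[OF fm p0(1) le(1)])
      have f0: "f \<in> Lp_funs unit_lebesgue p0"
        using f mono by (auto simp: Lp_funs_def)
      have "Lp_norm unit_lebesgue q (T_op \<gamma> N f) \<le> Lp_norm unit_lebesgue q0 (T_op \<gamma> N f)"
        by (rule unit.Lp_norm_mono[OF T_op_measurable[OF fm] q le(2)])
      also have "\<dots> \<le> ennreal (C * (1 + N) powr (-1 + x)) * Lp_norm unit_lebesgue p0 f"
        using C(2)[OF N p0(1) q0(1) _ _ f0 nz] p0 q0 x by simp
      also have "\<dots> \<le> ennreal (C * (1 + N) powr (-1 + x)) * Lp_norm unit_lebesgue p f"
        by (intro mult_left_mono mono) simp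
      finally show "Lp_norm unit_lebesgue q (T_op \<gamma> N f) / Lp_norm unit_lebesgue p f
          \<le> ennreal (C * (1 + N) powr (-1 + x))"
        using Lp_norm_pos[OF fm nz p] by (intro divide_le_posI_ennreal) (simp_all add: mult.commute)
    qed
  qed
qed

section \<open>Lower bounds\<close>

lemma cos_ge_half: "\<bar>x\<bar> \<le> 1 \<Longrightarrow> 1/2 \<le> cos (x::real)"
proof -
  assume x: "\<bar>x\<bar> \<le> 1"
  have "cos (pi / 3) \<le> cos \<bar>x\<bar>"
    using x pi_gt3 by (intro cos_monotone_0_pi_le) auto
  thus ?thesis by (simp add: cos_60)
qed

lemma abs_divide_diff_le:
  fixes u v :: real
  assumes "N \<ge> 0" "u \<ge> 1" "v \<ge> 1"
  shows "\<bar>N / u - N / v\<bar> \<le> N * \<bar>u - v\<bar>"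
proof -
  have "N / u - N / v = N * (v - u) / (u * v)" using assms by (simp add: field_simps)
  hence "\<bar>N / u - N / v\<bar> = N * \<bar>u - v\<bar> / (u * v)"
    using assms by (simp add: abs_mult abs_minus_commute)
  also have "\<dots> \<le> N * \<bar>u - v\<bar> / 1"
    using assms mult_mono[of 1 u 1 v] by (intro divide_left_mono) auto
  finally show ?thesis by simp
qed

text \<open>A phase within one radian of \<alpha> costs at most a factor 1/2, since 1 < pi/3, and
  the amplitude is at least 3^(-\<gamma>), since 1 + t + s \<le> 3. Every lower bound below inherits
  this constant.\<close>

lemma Re_kern_ge:
  assumes "\<gamma> \<ge> 0" "t \<in> {0..1}" "s \<in> {0..1}" "\<bar>N / (1 + t + s) - \<alpha>\<bar> \<le> 1"
  shows "3 powr (-\<gamma>) / 2 \<le> Re (exp (- (\<i> * of_real \<alpha>)) * kern \<gamma> N t s)"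
proof -
  have "exp (- (\<i> * of_real \<alpha>)) * kern \<gamma> N t s =
      exp (\<i> * of_real (N / (1 + t + s) - \<alpha>)) * of_real ((1 + t + s) powr (-\<gamma>))"
    by (simp add: kern_def powr_minus divide_inverse right_diff_distrib exp_diff exp_minus)
  hence eq: "Re (exp (- (\<i> * of_real \<alpha>)) * kern \<gamma> N t s) =
      cos (N / (1 + t + s) - \<alpha>) * (1 + t + s) powr (-\<gamma>)"
    by (simp add: Re_exp del: of_real_diff of_real_divide)
  have "1/2 * 3 powr (-\<gamma>) \<le> cos (N / (1 + t + s) - \<alpha>) * (1 + t + s) powr (-\<gamma>)"
  proof (intro mult_mono cos_ge_half assms(4))
    show "3 powr (-\<gamma>) \<le> (1 + t + s) powr (-\<gamma>)"
      using assms by (intro powr_mono2') auto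
    show "0 \<le> cos (N / (1 + t + s) - \<alpha>)" using cos_ge_half[OF assms(4)] by linarith
  qed auto
  thus ?thesis unfolding eq by simp
qed

text \<open>After rotation by exp (- i \<alpha>) the real parts of the integrand on \<open>S\<close>
  all have size at least c, and nothing outside \<open>S\<close> can cancel them.\<close>

lemma norm_T_op_ge:
  assumes f: "integrable unit_lebesgue f" and \<gamma>: "\<gamma> \<ge> 0" and t: "t \<ge> 0"
    and S: "S \<in> sets unit_lebesgue"
    and re: "\<And>s. s \<in> S \<Longrightarrow> c \<le> Re (exp (- (\<i> * of_real \<alpha>)) * (kern \<gamma> N t s * f s))"
    and zero: "\<And>s. s \<in> {0..1} - S \<Longrightarrow> f s = 0"
  shows "c * measure unit_lebesgue S \<le> cmod (T_op \<gamma> N f t)"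
proof -
  let ?e = "exp (- (\<i> * of_real \<alpha>))"
  have int: "integrable unit_lebesgue (\<lambda>s. ?e * (kern \<gamma> N t s * f s))"
    using integrable_kern_mult[OF f \<gamma> t] by simp
  have "c * measure unit_lebesgue S = (LINT s|unit_lebesgue. c * indicator S s)"
  proof -
    have "S \<inter> {0..1} = S" using sets.sets_into_space[OF S] by auto
    thus ?thesis by simp
  qed
  also have "\<dots> \<le> (LINT s|unit_lebesgue. Re (?e * (kern \<gamma> N t s * f s)))"
  proof (rule integral_mono)
    show "integrable unit_lebesgue (\<lambda>s. c * indicator S s)"
      using S by (intro integrable_mult_right integrable_real_indicator) (auto simp: less_top[symmetric])
    show "integrable unit_lebesgue (\<lambda>s. Re (?e * (kern \<gamma> N t s * f s)))"
      using int by (rule integrable_Re)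
    show "c * indicator S s \<le> Re (?e * (kern \<gamma> N t s * f s))" if "s \<in> space unit_lebesgue" for s
      using re[of s] zero[of s] that by (cases "s \<in> S") auto
  qed
  also have "\<dots> = Re (LINT s|unit_lebesgue. ?e * (kern \<gamma> N t s * f s))"
    by (rule integral_Re[OF int])
  also have "\<dots> = Re (?e * T_op \<gamma> N f t)"
    by (simp only: T_op_kern integral_mult_right_zero)
  also have "\<dots> \<le> cmod (?e * T_op \<gamma> N f t)" by (rule complex_Re_le_cmod)
  also have "\<dots> = cmod (T_op \<gamma> N f t)" by (simp add: norm_mult)
  finally show ?thesis .
qed

lemma Lp_norm_ge_on_set:
  assumes [measurable]: "f \<in> borel_measurable M" and S[measurable]: "S \<in> sets M"
    and \<delta>: "emeasure M S = ennreal \<delta>" "\<delta> > 0" and c: "c \<ge> 0"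
    and le: "\<And>x. x \<in> S \<Longrightarrow> c \<le> cmod (f x)" and q: "1 \<le> q"
  shows "ennreal (c * \<delta> powr recip q) \<le> Lp_norm M q f"
  using q
proof (cases rule: exponent_cases)
  case 1
  define E where "E = esssup M (\<lambda>x. ennreal (cmod (f x)))"
  have "ennreal c \<le> E"
  proof (rule ccontr)
    assume "\<not> ennreal c \<le> E"
    moreover have "AE x in M. ennreal (cmod (f x)) \<le> E" unfolding E_def by (rule esssup_AE)
    moreover have "ennreal c \<le> ennreal (cmod (f x))" if "x \<in> S" for x
      using le[OF that] by (rule ennreal_leI)
    ultimately have "AE x in M. x \<notin> S"
      by (metis (mono_tags, lifting) eventually_mono order_trans)
    hence "emeasure M S = 0"
      using S by (metis AE_iff_null_sets null_setsD1)
    thus False using \<delta> by simp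
  qed
  thus ?thesis using 1 \<delta> by (simp add: Lp_norm_def E_def)
next
  case (2 r)
  show ?thesis unfolding 2(3) unfolding 2(1)
  proof (rule Lp_norm_geI)
    have "ennreal ((c * \<delta> powr (1 / r)) powr r) = ennreal (c powr r) * emeasure M S"
      using 2 c \<delta> by (simp add: powr_mult powr_powr ennreal_mult')
    also have "\<dots> = (\<integral>\<^sup>+ x. ennreal (c powr r) * indicator S x \<partial>M)"
      using S by (simp only: nn_integral_cmult_indicator)
    also have "\<dots> \<le> (\<integral>\<^sup>+ x. ennreal (cmod (f x) powr r) \<partial>M)"
      using le c 2 by (intro nn_integral_mono) (auto simp: indicator_def intro!: ennreal_leI powr_mono2)
    finally show "ennreal ((c * \<delta> powr (1 / r)) powr r) \<le> (\<integral>\<^sup>+ x. ennreal (cmod (f x) powr r) \<partial>M)" .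
  qed (use 2 c in auto)
qed

lemma Lp_norm_zero:
  assumes "1 \<le> q"
  shows "Lp_norm M q (\<lambda>_. 0) = 0"
  using assms
proof (cases rule: exponent_cases)
  case 1
  have "Lp_norm M \<infinity> (\<lambda>_. 0) \<le> ennreal 0" by (rule Lp_norm_infinity_leI) auto
  thus ?thesis using 1 by simp
next
  case (2 r)
  have "Lp_norm M (ennreal r) (\<lambda>_. 0) \<le> ennreal 0" using 2 by (intro Lp_norm_leI) auto
  thus ?thesis using 2 by simp
qed

lemma C_const_geI:
  assumes fm: "f \<in> borel_measurable unit_lebesgue" and p: "1 \<le> p" and q: "1 \<le> q"
    and b: "Lp_norm unit_lebesgue p f \<le> ennreal b" "b > 0"
    and a: "ennreal a \<le> Lp_norm unit_lebesgue q (T_op \<gamma> N f)" "a > 0"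
  shows "ennreal (a / b) \<le> C_const \<gamma> N p q"
proof -
  \<comment> \<open>Admissibility in the supremum: an input vanishing almost everywhere would have
    output 0, against the positive lower bound \<open>a\<close>.\<close>
  have nz: "\<not> (AE x in unit_lebesgue. f x = 0)"
  proof
    assume ae: "AE x in unit_lebesgue. f x = 0"
    have "T_op \<gamma> N f t = 0" for t
    proof -
      have "T_op \<gamma> N f t = (LINT s|unit_lebesgue. 0)"
        unfolding T_op_kern
      proof (rule integral_cong_AE)
        note fm[measurable]
        show "(\<lambda>s. kern \<gamma> N t s * f s) \<in> borel_measurable unit_lebesgue" by measurable
      qed (use ae in auto)
      thus ?thesis by simp
    qed
    hence "T_op \<gamma> N f = (\<lambda>_. 0)" by auto
    thus False using a q by (simp add: Lp_norm_zero)
  qed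
  have pos: "0 < Lp_norm unit_lebesgue p f" by (rule Lp_norm_pos[OF fm nz p])
  have fin: "Lp_norm unit_lebesgue p f < \<infinity>" using b(1) by (simp add: le_less_trans)
  have "ennreal (a / b) = ennreal a / ennreal b" using a b by (simp add: divide_ennreal)
  also have "\<dots> \<le> Lp_norm unit_lebesgue q (T_op \<gamma> N f) / Lp_norm unit_lebesgue p f"
  proof -
    obtain b' where b': "Lp_norm unit_lebesgue p f = ennreal b'" "b' \<ge> 0"
      using fin by (cases "Lp_norm unit_lebesgue p f") auto
    hence "0 < b'" "b' \<le> b" using pos b by auto
    hence "inverse (ennreal b) \<le> inverse (ennreal b')"
      using b(2) by (simp add: inverse_ennreal le_imp_inverse_le)
    thus ?thesis unfolding divide_ennreal_def b'(1) by (intro mult_mono a(1)) auto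
  qed
  also have "\<dots> \<le> C_const \<gamma> N p q"
    unfolding C_const_def using nz fin fm by (intro SUP_upper) (auto simp: Lp_funs_def)
  finally show ?thesis .
qed

section \<open>Moments of random signed sums; a subset of {..<n} encodes a choice of signs\<close>

definition signed_sum :: "nat \<Rightarrow> (nat \<Rightarrow> complex) \<Rightarrow> nat set \<Rightarrow> complex" where
  "signed_sum n x S = (\<Sum>j<n. (if j \<in> S then 1 else -1) * x j)"

text \<open>Conditioning on the last sign: a subset of {..<Suc n} either omits n or contains it.
  This is the induction step for both moments.\<close>

lemma sum_Pow_lessThan_Suc:
  fixes \<phi> :: "complex \<Rightarrow> real"
  shows "(\<Sum>S\<in>Pow {..<Suc n}. \<phi> (signed_sum (Suc n) x S)) =
    (\<Sum>S\<in>Pow {..<n}. \<phi> (signed_sum n x S + x n) + \<phi> (signed_sum n x S - x n))"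
proof -
  have Z: "signed_sum (Suc n) x S = signed_sum n x S - x n"
      "signed_sum (Suc n) x (insert n S) = signed_sum n x S + x n" if "S \<in> Pow {..<n}" for S
  proof -
    have "n \<notin> S" using that by auto
    moreover have "(\<Sum>j<n. (if j \<in> insert n S then 1 else -1) * x j) = (\<Sum>j<n. (if j \<in> S then 1 else -1) * x j)"
      by (intro sum.cong) auto
    ultimately show "signed_sum (Suc n) x S = signed_sum n x S - x n"
      "signed_sum (Suc n) x (insert n S) = signed_sum n x S + x n"
      by (simp_all add: signed_sum_def)
  qed
  have inj: "inj_on (insert n) (Pow {..<n})"
    by (intro inj_onI) (metis Diff_insert_absorb PowD insert_ident lessThan_iff less_irrefl subsetD)
  have "Pow {..<Suc n} = Pow {..<n} \<union> insert n ` Pow {..<n}"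
    by (simp add: lessThan_Suc Pow_insert)
  also have "(\<Sum>S\<in>Pow {..<n} \<union> insert n ` Pow {..<n}. \<phi> (signed_sum (Suc n) x S)) =
      (\<Sum>S\<in>Pow {..<n}. \<phi> (signed_sum (Suc n) x S)) + (\<Sum>S\<in>insert n ` Pow {..<n}. \<phi> (signed_sum (Suc n) x S))"
    by (intro sum.union_disjoint) auto
  also have "(\<Sum>S\<in>insert n ` Pow {..<n}. \<phi> (signed_sum (Suc n) x S)) =
      (\<Sum>S\<in>Pow {..<n}. \<phi> (signed_sum n x S + x n))"
    using inj Z(2) by (simp add: sum.reindex)
  also have "(\<Sum>S\<in>Pow {..<n}. \<phi> (signed_sum (Suc n) x S)) = (\<Sum>S\<in>Pow {..<n}. \<phi> (signed_sum n x S - x n))"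
    using Z(1) by simp
  finally show ?thesis by (simp add: sum.distrib)
qed

lemma norm_sq_add_diff:
  "(cmod (z + x))\<^sup>2 + (cmod (z - x))\<^sup>2 = 2 * (cmod z)\<^sup>2 + 2 * (cmod x)\<^sup>2"
  unfolding cmod_power2 by (simp add: power2_eq_square algebra_simps)

text \<open>The squares |z + x|^2 and |z - x|^2 are m + d and m - d with d = 2 Re (z cnj x), so the
  fourth powers sum to 2 m^2 + 2 d^2. The coefficient 12 is 4 from 2 m^2 plus 8 from d^2 \<le> 4
  |x|^2 |z|^2.\<close>

lemma norm_pow4_add_diff:
  "(cmod (z + x))^4 + (cmod (z - x))^4 \<le> 2 * (cmod z)^4 + 12 * ((cmod x)\<^sup>2 * (cmod z)\<^sup>2) + 2 * (cmod x)^4"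
proof -
  define \<rho> where "\<rho> = Re (z * cnj x)"
  define d where "d = 2 * \<rho>"
  define m where "m = (cmod z)\<^sup>2 + (cmod x)\<^sup>2"
  have s: "(cmod (z + x))\<^sup>2 = m + d" "(cmod (z - x))\<^sup>2 = m - d"
    unfolding m_def d_def \<rho>_def cmod_power2 by (simp_all add: power2_eq_square algebra_simps)
  have p4: "y^4 = (y\<^sup>2)\<^sup>2" for y :: real by simp
  have "\<bar>\<rho>\<bar> \<le> cmod z * cmod x"
    unfolding \<rho>_def using abs_Re_le_cmod[of "z * cnj x"] by (simp only: norm_mult complex_mod_cnj)
  hence "\<rho>\<^sup>2 \<le> (cmod z * cmod x)\<^sup>2"
    by (metis abs_ge_zero power2_abs power_mono)
  hence d: "d\<^sup>2 \<le> 4 * ((cmod x)\<^sup>2 * (cmod z)\<^sup>2)"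
    by (simp add: d_def power_mult_distrib mult.commute)
  have "(cmod (z + x))^4 + (cmod (z - x))^4 = (m + d)\<^sup>2 + (m - d)\<^sup>2"
    unfolding p4 s ..
  also have "\<dots> = 2 * m\<^sup>2 + 2 * d\<^sup>2" by (simp add: power2_eq_square algebra_simps)
  also have "\<dots> \<le> 2 * m\<^sup>2 + 8 * ((cmod x)\<^sup>2 * (cmod z)\<^sup>2)" using d by simp
  also have "\<dots> = 2 * (cmod z)^4 + 12 * ((cmod x)\<^sup>2 * (cmod z)\<^sup>2) + 2 * (cmod x)^4"
    unfolding m_def by algebra
  finally show ?thesis .
qed

lemma signed_sum_second_moment:
  "(\<Sum>S\<in>Pow {..<n}. (cmod (signed_sum n x S))\<^sup>2) = 2^n * (\<Sum>j<n. (cmod (x j))\<^sup>2)"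
proof (induction n)
  case (Suc n)
  have "(\<Sum>S\<in>Pow {..<Suc n}. (cmod (signed_sum (Suc n) x S))\<^sup>2) =
      (\<Sum>S\<in>Pow {..<n}. 2 * (cmod (signed_sum n x S))\<^sup>2 + 2 * (cmod (x n))\<^sup>2)"
    unfolding sum_Pow_lessThan_Suc[of "\<lambda>z. (cmod z)\<^sup>2"] norm_sq_add_diff ..
  also have "\<dots> = 2 * (2^n * (\<Sum>j<n. (cmod (x j))\<^sup>2)) + 2^n * (2 * (cmod (x n))\<^sup>2)"
    by (simp add: sum.distrib card_Pow flip: sum_distrib_left Suc)
  finally show ?case by (simp add: algebra_simps)
qed (simp add: signed_sum_def)

text \<open>The constant 3 is what the induction dictates: the cross term 12 y \<sigma> is exactly
  that of 6 (\<sigma> + y)^2, and only the y^2 term has slack, 2 against 6.\<close>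

lemma signed_sum_fourth_moment:
  "(\<Sum>S\<in>Pow {..<n}. (cmod (signed_sum n x S))^4) \<le> 3 * 2^n * (\<Sum>j<n. (cmod (x j))\<^sup>2)\<^sup>2"
proof (induction n)
  case (Suc n)
  define \<sigma> where "\<sigma> = (\<Sum>j<n. (cmod (x j))\<^sup>2)"
  define y where "y = (cmod (x n))\<^sup>2"
  have y4: "(cmod (x n))^4 = y\<^sup>2" by (simp add: y_def)
  have "(\<Sum>S\<in>Pow {..<Suc n}. (cmod (signed_sum (Suc n) x S))^4) \<le>
      (\<Sum>S\<in>Pow {..<n}. 2 * (cmod (signed_sum n x S))^4 + 12 * (y * (cmod (signed_sum n x S))\<^sup>2) + 2 * y\<^sup>2)"
    unfolding sum_Pow_lessThan_Suc[of "\<lambda>z. (cmod z)^4"] y4[symmetric] unfolding y_def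
    by (intro sum_mono norm_pow4_add_diff)
  also have "\<dots> = 2 * (\<Sum>S\<in>Pow {..<n}. (cmod (signed_sum n x S))^4)
      + 12 * (y * (\<Sum>S\<in>Pow {..<n}. (cmod (signed_sum n x S))\<^sup>2)) + 2^n * (2 * y\<^sup>2)"
    by (simp add: sum.distrib card_Pow flip: sum_distrib_left)
  also have "\<dots> \<le> 2 * (3 * 2^n * \<sigma>\<^sup>2) + 12 * (y * (2^n * \<sigma>)) + 2^n * (2 * y\<^sup>2)"
    using Suc unfolding signed_sum_second_moment \<sigma>_def by simp
  also have "\<dots> \<le> 2 * (3 * 2^n * \<sigma>\<^sup>2) + 12 * (y * (2^n * \<sigma>)) + 2^n * (6 * y\<^sup>2)"
    by simp
  also have "\<dots> = 3 * 2^Suc n * (\<sigma> + y)\<^sup>2"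
    by (simp add: power2_eq_square algebra_simps)
  finally show ?case by (simp add: \<sigma>_def y_def)
qed (simp add: signed_sum_def)

text \<open>Khintchine's inequality in \<open>L\<^sup>1\<close>: with \<open>y = |X| / \<tau>\<close> one has
  \<open>y - y\<^sup>2 + 4/27 y\<^sup>4 = 4/27 y (y - 3/2)\<^sup>2 (y + 3) \<ge> 0\<close>.\<close>

lemma signed_sum_first_moment:
  assumes \<tau>: "\<tau> > 0" "\<tau>\<^sup>2 = (\<Sum>j<n. (cmod (x j))\<^sup>2)"
  shows "5/9 * 2^n * \<tau> \<le> (\<Sum>S\<in>Pow {..<n}. cmod (signed_sum n x S))"
proof -
  have pt: "w\<^sup>2 / \<tau> - 4/27 * (w^4 / \<tau>^3) \<le> w" if "w \<ge> 0" for w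
  proof -
    define y where "y = w / \<tau>"
    have y: "y \<ge> 0" "w = \<tau> * y" using that \<tau> by (simp_all add: y_def)
    have "0 \<le> \<tau> * (4/27 * y * (y - 3/2)\<^sup>2 * (y + 3))" using y \<tau> by simp
    also have "\<dots> = \<tau> * (y - y\<^sup>2 + 4/27 * y^4)"
      by (simp add: power2_eq_square power4_eq_xxxx field_simps)
    also have "\<dots> = w - (w\<^sup>2 / \<tau> - 4/27 * (w^4 / \<tau>^3))"
      using \<tau>(1) by (simp add: y(2) field_simps power2_eq_square power3_eq_cube power4_eq_xxxx)
    finally show ?thesis by simp
  qed
  have "(\<tau>\<^sup>2)\<^sup>2 / \<tau>^3 = \<tau>" using \<tau>(1) by (simp add: field_simps power2_eq_square power3_eq_cube)
  \<comment> \<open>Here 5/9 = 1 - 3 * 4/27, from the exact second moment and the constant 3 of the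
    fourth. The number 4/27 is the maximum of (y - 1)/y^3, attained at y = 3/2.\<close>
  hence "5/9 * 2^n * \<tau> = (2^n * \<tau>\<^sup>2) / \<tau> - 4/27 * ((3 * 2^n * (\<tau>\<^sup>2)\<^sup>2) / \<tau>^3)"
    using \<tau>(1) by (simp add: power2_eq_square flip: times_divide_eq_right)
  also have "\<dots> \<le> (\<Sum>S\<in>Pow {..<n}. (cmod (signed_sum n x S))\<^sup>2) / \<tau>
      - 4/27 * ((\<Sum>S\<in>Pow {..<n}. (cmod (signed_sum n x S))^4) / \<tau>^3)"
    unfolding \<tau>(2) signed_sum_second_moment
    using signed_sum_fourth_moment[of n x] \<tau>(1)
    by (intro diff_left_mono mult_left_mono divide_right_mono) auto
  also have "\<dots> = (\<Sum>S\<in>Pow {..<n}. (cmod (signed_sum n x S))\<^sup>2 / \<tau> - 4/27 * ((cmod (signed_sum n x S))^4 / \<tau>^3))"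
    by (simp add: sum_subtractf sum_divide_distrib sum_distrib_left)
  also have "\<dots> \<le> (\<Sum>S\<in>Pow {..<n}. cmod (signed_sum n x S))"
    by (intro sum_mono pt) simp
  finally show ?thesis .
qed

section \<open>Test functions for the three lower bounds\<close>

lemma T_op_interval_ge:
  assumes \<gamma>: "\<gamma> \<ge> 0" and N: "N \<ge> 0" and t: "t \<in> {0..1}"
    and S: "S \<in> sets borel" "S \<subseteq> {a..a + \<delta>}" "S \<subseteq> {0..1}" and a: "a \<in> {0..1}" and \<delta>: "N * \<delta> \<le> 1"
  shows "3 powr (-\<gamma>) / 2 * measure lborel S \<le> cmod (T_op \<gamma> N (indicator S) t)"
proof -
  have SM: "S \<in> sets unit_lebesgue" using S by (auto simp: sets_restrict_space_iff)
  have int: "integrable unit_lebesgue (indicator S :: real \<Rightarrow> complex)"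
    by (rule unit.integrable_const_bound[where B = 1]) (use SM in \<open>auto simp: indicator_def intro!: AE_I2\<close>)
  have "3 powr (-\<gamma>) / 2 * measure unit_lebesgue S \<le> cmod (T_op \<gamma> N (indicator S) t)"
  \<comment> \<open>The phase is frozen at the left end of the interval, over which it moves by at
    most N \<delta> \<le> 1. As \<alpha> may depend on t, the bound holds at every t in
    [0,1].\<close>
  proof (rule norm_T_op_ge[OF int \<gamma> _ SM, where \<alpha> = "N / (1 + t + a)"])
    fix s assume s: "s \<in> S"
    have "\<bar>N / (1 + t + s) - N / (1 + t + a)\<bar> \<le> N * \<bar>s - a\<bar>"
      using abs_divide_diff_le[OF N, of "1 + t + s" "1 + t + a"] s S t a by auto
    also have "\<dots> \<le> N * \<delta>" using s S N by (intro mult_left_mono) auto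
    finally have "\<bar>N / (1 + t + s) - N / (1 + t + a)\<bar> \<le> 1" using \<delta> by simp
    thus "3 powr (-\<gamma>) / 2 \<le> Re (exp (- (\<i> * of_real (N / (1 + t + a)))) * (kern \<gamma> N t s * indicator S s))"
      using Re_kern_ge[OF \<gamma> t, of s N "N / (1 + t + a)"] s S by auto
  qed (use t in \<open>auto simp: indicator_def\<close>)
  moreover have "measure unit_lebesgue S = measure lborel S"
    using S by (simp add: measure_restrict_space measure_completion)
  ultimately show ?thesis by simp
qed

lemma emeasure_unit_lebesgue_Icc:
  assumes "0 \<le> \<delta>" "\<delta> \<le> 1"
  shows "emeasure unit_lebesgue {0..\<delta>} = ennreal \<delta>"
  using assms by (simp add: emeasure_restrict_space)

text \<open>The output is at least c \<delta> on all of [0,1], so the bound is the same for every q.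
  The input has norm at most \<delta>^(1/p), and the quotient is c \<delta>^(1 - 1/p).\<close>

lemma C_const_lower_concentrated:
  assumes \<gamma>: "\<gamma> \<ge> 0" and N: "N \<ge> 0" and p: "1 \<le> p" and q: "1 \<le> q" and rp: "recip p > 0"
  shows "ennreal (3 powr (-\<gamma>) / 2 * (1 + N) powr (-1 + recip p)) \<le> C_const \<gamma> N p q"
proof -
  define \<delta> where "\<delta> = 1 / (1 + N)"
  have \<delta>: "0 < \<delta>" "\<delta> \<le> 1" "N * \<delta> \<le> 1" using N by (auto simp: \<delta>_def)
  define c where "c = 3 powr (-\<gamma>) / 2"
  have c: "c > 0" by (simp add: c_def)
  define f :: "real \<Rightarrow> complex" where "f = indicator {0..\<delta>}"
  have fm[measurable]: "f \<in> borel_measurable unit_lebesgue"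
    unfolding f_def using \<delta> by (intro borel_measurable_indicator) (auto simp: sets_restrict_space_iff)
  obtain r where r: "p = ennreal r" "r \<ge> 1" "recip p = 1 / r"
    using p by (cases rule: exponent_cases) (use rp in auto)
  have "Lp_norm unit_lebesgue (ennreal r) f \<le> ennreal (\<delta> powr (1 / r))"
  proof (rule Lp_norm_leI)
    have "(\<integral>\<^sup>+ x. ennreal (cmod (f x) powr r) \<partial>unit_lebesgue) = (\<integral>\<^sup>+ x. indicator {0..\<delta>} x \<partial>unit_lebesgue)"
      using r by (intro nn_integral_cong) (auto simp: f_def indicator_def)
    also have "\<dots> = emeasure unit_lebesgue {0..\<delta>}"
      using \<delta> by (intro nn_integral_indicator) (auto simp: sets_restrict_space_iff)
    finally show "(\<integral>\<^sup>+ x. ennreal (cmod (f x) powr r) \<partial>unit_lebesgue) \<le> ennreal ((\<delta> powr (1 / r)) powr r)"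
      using \<delta> r by (simp add: emeasure_unit_lebesgue_Icc powr_powr)
  qed (use r in auto)
  moreover have "ennreal (c * \<delta> * 1 powr recip q) \<le> Lp_norm unit_lebesgue q (T_op \<gamma> N f)"
  proof (rule Lp_norm_ge_on_set[where S = "{0..1}"])
    show "T_op \<gamma> N f \<in> borel_measurable unit_lebesgue" by (rule T_op_measurable[OF fm])
    show "c * \<delta> \<le> cmod (T_op \<gamma> N f t)" if "t \<in> {0..1}" for t
      using T_op_interval_ge[OF \<gamma> N that, of "{0..\<delta>}" 0 \<delta>] \<delta> by (simp add: c_def f_def)
  qed (use \<delta> c q in \<open>auto simp: emeasure_restrict_space sets_restrict_space_iff\<close>)
  ultimately have "ennreal (c * \<delta> / \<delta> powr (1 / r)) \<le> C_const \<gamma> N p q"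
    using r \<delta> c by (intro C_const_geI[OF fm p q]) auto
  also have "c * \<delta> / \<delta> powr (1 / r) = c * (1 + N) powr (-1 + recip p)"
    using N unfolding r(3) by (simp add: \<delta>_def powr_divide powr_diff)
  finally show ?thesis by (simp add: c_def)
qed

lemma Lp_norm_le_1:
  assumes fm: "f \<in> borel_measurable unit_lebesgue" and "\<And>s. s \<in> {0..1} \<Longrightarrow> cmod (f s) \<le> 1" and p: "1 \<le> p"
  shows "Lp_norm unit_lebesgue p f \<le> ennreal 1"
proof -
  have "Lp_norm unit_lebesgue p f \<le> Lp_norm unit_lebesgue \<infinity> f"
    by (rule unit.Lp_norm_mono[OF fm p]) simp
  also have "\<dots> \<le> ennreal 1" using assms by (intro Lp_norm_infinity_leI AE_I2) auto
  finally show ?thesis .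
qed

text \<open>The mirror image of the concentrated input: a unimodular function has norm at most 1 for
  every p, while its output is at least c on [0, \<delta>], which gives c \<delta>^(1/q).\<close>

lemma C_const_lower_cancelled_phase:
  assumes \<gamma>: "\<gamma> \<ge> 0" and N: "N \<ge> 0" and p: "1 \<le> p" and q: "1 \<le> q"
  shows "ennreal (3 powr (-\<gamma>) / 2 * (1 + N) powr (- recip q)) \<le> C_const \<gamma> N p q"
proof -
  define \<delta> where "\<delta> = 1 / (1 + N)"
  have \<delta>: "0 < \<delta>" "\<delta> \<le> 1" "N * \<delta> \<le> 1" using N by (auto simp: \<delta>_def)
  define c where "c = 3 powr (-\<gamma>) / 2"
  have c: "c > 0" by (simp add: c_def)
  define f :: "real \<Rightarrow> complex" where "f s = exp (- (\<i> * of_real (N / (1 + s))))" for s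
  have nf: "cmod (f s) = 1" for s by (simp add: f_def norm_exp_eq_Re)
  have fm[measurable]: "f \<in> borel_measurable unit_lebesgue"
    unfolding f_def[abs_def] by measurable
  have fi: "integrable unit_lebesgue f"
    by (rule unit.integrable_const_bound[where B = 1, OF _ fm]) (simp add: nf)
  have "ennreal (c * \<delta> powr recip q) \<le> Lp_norm unit_lebesgue q (T_op \<gamma> N f)"
  proof (rule Lp_norm_ge_on_set[where S = "{0..\<delta>}"])
    show "T_op \<gamma> N f \<in> borel_measurable unit_lebesgue" by (rule T_op_measurable[OF fm])
    show "c \<le> cmod (T_op \<gamma> N f t)" if t: "t \<in> {0..\<delta>}" for t
    proof -
      have "c * measure unit_lebesgue {0..1} \<le> cmod (T_op \<gamma> N f t)"
      proof (rule norm_T_op_ge[OF fi \<gamma>, where \<alpha> = 0])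
        fix s :: real assume s: "s \<in> {0..1}"
        have "\<bar>N / (1 + t + s) - N / (1 + s)\<bar> \<le> N * \<bar>t\<bar>"
          using abs_divide_diff_le[OF N, of "1 + t + s" "1 + s"] s t by auto
        also have "\<dots> \<le> N * \<delta>" using t N by (intro mult_left_mono) auto
        finally have "\<bar>N / (1 + t + s) - N / (1 + s)\<bar> \<le> 1" using \<delta> by simp
        hence "c \<le> Re (f s * kern \<gamma> N t s)"
          unfolding c_def f_def using t \<delta> s by (intro Re_kern_ge \<gamma>) auto
        thus "c \<le> Re (exp (- (\<i> * of_real 0)) * (kern \<gamma> N t s * f s))"
          by (simp add: mult.commute)
      qed (use t in \<open>auto simp: sets_restrict_space_iff\<close>)
      thus ?thesis by (simp add: measure_restrict_space)
    qed
  qed (use \<delta> c q in \<open>auto simp: emeasure_unit_lebesgue_Icc sets_restrict_space_iff\<close>)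
  hence "ennreal (c * \<delta> powr recip q / 1) \<le> C_const \<gamma> N p q"
    using \<delta> c p by (intro C_const_geI[OF fm p q] Lp_norm_le_1 fm) (auto simp: nf)
  also have "c * \<delta> powr recip q / 1 = c * (1 + N) powr (- recip q)"
    using N by (simp add: \<delta>_def powr_divide powr_minus_divide)
  finally show ?thesis by (simp add: c_def)
qed

text \<open>Each interval contributes at least c/n to the output at every t, so the square function
  of the contributions is at least c / sqrt n. Averaging over signs and t yields one choice of signs
  with a large L^1 norm. The input has modulus at most 1 and L^1 is the smallest output norm, so one
  bound covers all p and q.\<close>

lemma C_const_lower_random_signs:
  assumes \<gamma>: "\<gamma> \<ge> 0" and N: "N \<ge> 0" and p: "1 \<le> p" and q: "1 \<le> q"
  shows "ennreal (3 powr (-\<gamma>) / 6 * (1 + N) powr (-1/2)) \<le> C_const \<gamma> N p q"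
proof -
  let ?M = unit_lebesgue
  define c where "c = 3 powr (-\<gamma>) / 2"
  have c: "c > 0" by (simp add: c_def)
  \<comment> \<open>The summand 1 keeps n positive when N = 0. The bound n \<ge> N limits the phase
    variation on an interval of length 1/n to 1, and n \<le> N + 2 keeps 1 / sqrt n comparable to
    the claimed rate.\<close>
  define n where "n = nat \<lceil>N\<rceil> + 1"
  have n: "real n \<ge> N" "real n \<le> N + 2" "n \<ge> 1" using N unfolding n_def by linarith+
  have n0: "real n > 0" using n by simp
  define A where "A j = {real j / n..<(real j + 1) / n}" for j
  have A01: "A j \<subseteq> {0..1}" if "j < n" for j
  proof -
    have "real j + 1 \<le> n" using that by simp
    hence hi: "(real j + 1) / n \<le> 1" using n0 by simp
    have lo: "0 \<le> real j / n" by simp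
    show ?thesis
    proof
      fix x assume "x \<in> A j"
      hence "real j / n \<le> x" "x < (real j + 1) / n" unfolding A_def by simp_all
      thus "x \<in> {0..1}" using lo hi unfolding atLeastAtMost_iff by linarith
    qed
  qed
  have Am: "A j \<in> sets borel" for j by (simp add: A_def)
  have Ai: "integrable ?M (indicator (A j) :: real \<Rightarrow> complex)" for j
    by (rule unit.integrable_const_bound[where B = 1])
      (use Am in \<open>auto simp: indicator_def A_def intro!: AE_I2\<close>)
  have Aiff: "s \<in> A j \<longleftrightarrow> nat \<lfloor>s * n\<rfloor> = j" if "s \<ge> 0" for s j
  proof -
    have "s \<in> A j \<longleftrightarrow> real j \<le> s * n \<and> s * n < real j + 1"
      using n0 by (simp add: A_def field_simps)
    also have "\<dots> \<longleftrightarrow> \<lfloor>s * n\<rfloor> = int j" by (simp add: floor_eq_iff)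
    also have "\<dots> \<longleftrightarrow> nat \<lfloor>s * n\<rfloor> = j" using that n0 by (auto simp: nat_eq_iff2)
    finally show ?thesis .
  qed
  define X where "X j t = T_op \<gamma> N (indicator (A j)) t" for j t
  define f where "f S s = (\<Sum>j<n. (if j \<in> S then 1 else -1) * (indicator (A j) s :: complex))" for S s
  have fm[measurable]: "f S \<in> borel_measurable ?M" for S
    unfolding f_def[abs_def] using Ai
    by (intro borel_measurable_sum borel_measurable_times borel_measurable_const borel_measurable_integrable)
  have f1: "cmod (f S s) \<le> 1" if s: "s \<in> {0..1}" for S s
  proof -
    \<comment> \<open>The half-open intervals are disjoint, so at most one term survives. At s = 1
      the index is n, outside the range, and the sum is 0.\<close>
    have "f S s = (\<Sum>j<n. if nat \<lfloor>s * n\<rfloor> = j then (if j \<in> S then 1 else -1) else 0)"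
      unfolding f_def using Aiff s by (intro sum.cong) (auto simp: indicator_def)
    thus ?thesis by simp
  qed
  have Tf: "T_op \<gamma> N (f S) t = signed_sum n (\<lambda>j. X j t) S" if "t \<in> {0..1}" for S t
    unfolding f_def[abs_def] signed_sum_def X_def
    using that by (intro T_op_sum \<gamma> Ai) auto
  have X: "c / n \<le> cmod (X j t)" if "j < n" "t \<in> {0..1}" for j t
  proof -
    have "3 powr (-\<gamma>) / 2 * measure lborel (A j) \<le> cmod (T_op \<gamma> N (indicator (A j)) t)"
    proof (rule T_op_interval_ge[OF \<gamma> N that(2) Am _ A01[OF that(1)], where \<delta> = "1 / n" and a = "real j / n"])
      show "A j \<subseteq> {real j / n..real j / n + 1 / n}" by (auto simp: A_def add_divide_distrib)
      show "real j / n \<in> {0..1}" using that by auto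
      show "N * (1 / n) \<le> 1" using n n0 by (simp add: field_simps)
    qed
    moreover have "measure lborel (A j) = 1 / n"
      using n0 by (simp add: A_def field_simps)
    ultimately show ?thesis by (simp add: c_def X_def)
  qed
  have Tint: "integrable ?M (\<lambda>t. cmod (T_op \<gamma> N (f S) t))" for S
  proof -
    have fi: "integrable ?M (f S)"
      by (rule unit.integrable_const_bound[where B = 1, OF _ fm]) (use f1 in \<open>auto intro!: AE_I2\<close>)
    have "integrable ?M (T_op \<gamma> N (f S))"
    proof (rule unit.integrable_const_bound[where B = "LINT s|?M. cmod (f S s)"])
      show "AE t in ?M. cmod (T_op \<gamma> N (f S) t) \<le> (LINT s|?M. cmod (f S s))"
        using norm_T_op_le[OF fi \<gamma>] by (intro AE_I2) auto
      show "T_op \<gamma> N (f S) \<in> borel_measurable ?M" by (rule T_op_measurable[OF fm])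
    qed
    thus ?thesis by simp
  qed
  define \<kappa> where "\<kappa> = 5/9 * (c / sqrt n)"
  have avg: "2^n * \<kappa> \<le> (\<Sum>S\<in>Pow {..<n}. cmod (T_op \<gamma> N (f S) t))" if t: "t \<in> {0..1}" for t
  proof -
    define \<tau> where "\<tau> = sqrt (\<Sum>j<n. (cmod (X j t))\<^sup>2)"
    have "c / sqrt n = sqrt (\<Sum>j<n. (c / n)\<^sup>2)"
      using c n0 by (simp add: real_sqrt_mult real_sqrt_divide power_divide) (simp add: field_simps power2_eq_square)
    also have "\<dots> \<le> \<tau>"
      unfolding \<tau>_def using X t c by (intro real_sqrt_le_mono sum_mono power_mono) auto
    finally have \<tau>: "c / sqrt n \<le> \<tau>" .
    have "c / sqrt n > 0" using c n0 by simp
    hence "\<tau> > 0" using \<tau> by linarith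
    moreover have "\<tau>\<^sup>2 = (\<Sum>j<n. (cmod (X j t))\<^sup>2)" unfolding \<tau>_def by (simp add: sum_nonneg)
    ultimately have "5/9 * 2^n * \<tau> \<le> (\<Sum>S\<in>Pow {..<n}. cmod (signed_sum n (\<lambda>j. X j t) S))"
      by (rule signed_sum_first_moment)
    moreover have "2^n * \<kappa> \<le> 5/9 * 2^n * \<tau>"
      using mult_left_mono[OF \<tau>, of "5/9 * 2^n"] by (simp add: \<kappa>_def ac_simps)
    ultimately show ?thesis unfolding Tf[OF t] by (rule order_trans[rotated])
  qed
  \<comment> \<open>If every choice of signs stayed below \<kappa>, their sum would contradict the
    integral of \<open>avg\<close> over t.\<close>
  have "\<exists>S\<in>Pow {..<n}. \<kappa> \<le> (LINT t|?M. cmod (T_op \<gamma> N (f S) t))"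
  proof (rule ccontr)
    assume "\<not> ?thesis"
    hence "(\<Sum>S\<in>Pow {..<n}. LINT t|?M. cmod (T_op \<gamma> N (f S) t)) < (\<Sum>S\<in>Pow {..<n}. \<kappa>)"
      by (intro sum_strict_mono) (auto simp: not_le)
    also have "\<dots> = (LINT t|?M. 2^n * \<kappa>)" by (simp add: card_Pow measure_restrict_space)
    also have "\<dots> \<le> (LINT t|?M. (\<Sum>S\<in>Pow {..<n}. cmod (T_op \<gamma> N (f S) t)))"
      using Tint avg by (intro integral_mono) auto
    also have "\<dots> = (\<Sum>S\<in>Pow {..<n}. LINT t|?M. cmod (T_op \<gamma> N (f S) t))"
      using Tint by (intro Bochner_Integration.integral_sum)
    finally show False by simp
  qed
  then obtain S where S: "\<kappa> \<le> (LINT t|?M. cmod (T_op \<gamma> N (f S) t))" by blast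
  have "ennreal \<kappa> \<le> ennreal (LINT t|?M. cmod (T_op \<gamma> N (f S) t))" using S by (rule ennreal_leI)
  also have "\<dots> = Lp_norm ?M 1 (T_op \<gamma> N (f S))"
    unfolding Lp_norm_1 by (intro nn_integral_eq_integral[symmetric] Tint) simp
  also have "\<dots> \<le> Lp_norm ?M q (T_op \<gamma> N (f S))"
    by (intro unit.Lp_norm_mono T_op_measurable fm q) simp
  finally have "ennreal (\<kappa> / 1) \<le> C_const \<gamma> N p q"
    using c n0 by (intro C_const_geI[OF fm p q] Lp_norm_le_1 fm f1 p) (auto simp: \<kappa>_def)
  moreover have "c / 3 * (1 + N) powr (-1/2) \<le> \<kappa> / 1"
  proof -
    \<comment> \<open>The factor 5/3 turns 5/9 into 1/3, and it suffices because 25/9 (1 + N) \<ge>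
      N + 2 \<ge> n.\<close>
    have "(5/3 * sqrt (1 + N))\<^sup>2 = 25/9 * (1 + N)"
      using N by (simp add: power_mult_distrib power_divide)
    hence "sqrt n \<le> 5/3 * sqrt (1 + N)"
      using n N by (intro real_le_lsqrt) auto
    hence "c / (5/3 * sqrt (1 + N)) \<le> c / sqrt n"
      using c n0 N by (intro divide_left_mono) (auto intro!: mult_pos_pos)
    moreover have "(1 + N) powr (-1/2) = 1 / sqrt (1 + N)"
      using N powr_minus_divide[of "1 + N" "1/2"] by (simp add: powr_half_sqrt)
    ultimately show ?thesis by (simp add: \<kappa>_def)
  qed
  ultimately have "ennreal (c / 3 * (1 + N) powr (-1/2)) \<le> C_const \<gamma> N p q"
    by (meson ennreal_leI order_trans)
  thus ?thesis by (simp add: c_def)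
qed

theorem theorem5p1:
  fixes \<gamma> :: real
  assumes "\<gamma> \<ge> 0"
  shows "\<exists>cA cB cC :: real. cA > 0 \<and> cB > 0 \<and> cC > 0 \<and>
    (\<forall>N::real. \<forall>p q :: ennreal. N \<ge> 0 \<longrightarrow> 1 \<le> p \<longrightarrow> 1 \<le> q \<longrightarrow>
      (1/2 \<le> recip p \<and> recip p \<le> 1 \<and> 1 - recip p \<le> recip q \<and> recip q \<le> 1 \<longrightarrow>
         ennreal (inverse cA * (1 + N) powr (-1 + recip p)) \<le> C_const \<gamma> N p q \<and>
         C_const \<gamma> N p q \<le> ennreal (cA * (1 + N) powr (-1 + recip p))) \<and>
      (0 \<le> recip q \<and> recip q \<le> 1/2 \<and> 0 \<le> recip p \<and> recip p \<le> 1 - recip q \<longrightarrow>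
         ennreal (inverse cB * (1 + N) powr (- recip q)) \<le> C_const \<gamma> N p q \<and>
         C_const \<gamma> N p q \<le> ennreal (cB * (1 + N) powr (- recip q))) \<and>
      (0 \<le> recip p \<and> recip p \<le> 1/2 \<and> 1/2 \<le> recip q \<and> recip q \<le> 1 \<longrightarrow>
         ennreal (inverse cC * (1 + N) powr (-1/2)) \<le> C_const \<gamma> N p q \<and>
         C_const \<gamma> N p q \<le> ennreal (cC * (1 + N) powr (-1/2))))"
proof -
  obtain C where C: "C \<ge> 1"
    "\<And>N p q x. N \<ge> 0 \<Longrightarrow> 1 \<le> p \<Longrightarrow> 1 \<le> q \<Longrightarrow> 1/2 \<le> x \<Longrightarrow> x \<le> 1 \<Longrightarrow> recip p \<le> x \<Longrightarrow> 1 - x \<le> recip q \<Longrightarrow>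
       C_const \<gamma> N p q \<le> ennreal (C * (1 + N) powr (-1 + x))"
    using C_const_upper[OF assms] by metis
  \<comment> \<open>One constant serves all regions: 6 * 3 powr \<gamma> is the reciprocal of the
    smallest constant in the lower bounds, 3 powr (-\<gamma>) / 6.\<close>
  define K where "K = max C (6 * 3 powr \<gamma>)"
  have K: "K > 0" "C \<le> K" using C by (auto simp: K_def)
  have up: "C_const \<gamma> N p q \<le> ennreal (K * y)"
    if "C_const \<gamma> N p q \<le> ennreal (C * y)" "y \<ge> 0" for N p q y
    using that K by (meson ennreal_leI mult_right_mono order_trans)
  have "inverse K \<le> inverse (6 * 3 powr \<gamma>)"
    by (intro le_imp_inverse_le) (auto simp: K_def)
  hence iK: "inverse K \<le> 3 powr (-\<gamma>) / 6" "inverse K \<le> 3 powr (-\<gamma>) / 2"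
    by (auto simp: powr_minus field_simps)
  have low: "ennreal (inverse K * y) \<le> C_const \<gamma> N p q"
    if "ennreal (d * y) \<le> C_const \<gamma> N p q" "inverse K \<le> d" "y \<ge> 0" for N p q y d
    using that by (meson ennreal_leI mult_right_mono order_trans)
  show ?thesis
  proof (intro exI[of _ K] conjI allI impI K)
    fix N :: real and p q :: ennreal
    assume N: "N \<ge> 0" and p: "1 \<le> p" and q: "1 \<le> q"
    {
      \<comment> \<open>Here x = 1/p, and 1/p \<ge> 1/2 makes p finite, as the concentrated input
        requires. The other two regions take x = 1 - 1/q and x = 1/2.\<close>
      assume "1/2 \<le> recip p \<and> recip p \<le> 1 \<and> 1 - recip p \<le> recip q \<and> recip q \<le> 1"
      thus "ennreal (inverse K * (1 + N) powr (-1 + recip p)) \<le> C_const \<gamma> N p q"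
        "C_const \<gamma> N p q \<le> ennreal (K * (1 + N) powr (-1 + recip p))"
        using low[OF C_const_lower_concentrated[OF assms N p q] iK(2)] up[OF C(2)[OF N p q, of "recip p"]] by auto
    next
      assume "0 \<le> recip q \<and> recip q \<le> 1/2 \<and> 0 \<le> recip p \<and> recip p \<le> 1 - recip q"
      thus "ennreal (inverse K * (1 + N) powr (- recip q)) \<le> C_const \<gamma> N p q"
        "C_const \<gamma> N p q \<le> ennreal (K * (1 + N) powr (- recip q))"
        using low[OF C_const_lower_cancelled_phase[OF assms N p q] iK(2)] up[OF C(2)[OF N p q, of "1 - recip q"]] by auto
    next
      assume "0 \<le> recip p \<and> recip p \<le> 1/2 \<and> 1/2 \<le> recip q \<and> recip q \<le> 1"
      thus "ennreal (inverse K * (1 + N) powr (-1/2)) \<le> C_const \<gamma> N p q"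
        "C_const \<gamma> N p q \<le> ennreal (K * (1 + N) powr (-1/2))"
        using low[OF C_const_lower_random_signs[OF assms N p q] iK(1)] up[OF C(2)[OF N p q, of "1/2"]] by auto
    }
  qed
qed

end
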